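(* Let $n$ be a positive odd integer and let $a,b$ be indeterminates. Then, modulo $\Phi_n(q)(1-aq^n)(a-q^n)$, \[ \sum_{k=0}^{(n-1)/2} [4k+1]\frac{(aq, q/a, bq;q^2)_k\, (q;q^2)_k^3} {(aq^2, q^2/a, q^2/b;q^2)_k\, (q^2;q^2)_k^3}\left(\frac{q}{b}\right)^k \equiv [n]\,q^{(1-n)/2} \sum_{k=0}^{(n-1)/2}\frac{(aq, q/a, q/b, q;q^2)_k} {(q^2/b;q^2)_k\, (q^2;q^2)_k^3}\,q^{2k}. \]
   Context: Here $q,a,b$ are indeterminates. For $x$ and a base $p$ (a power of $q$), $(x;p)_k=\prod_{j=0}^{k-1}(1-xp^j)$ and $(x_1,\dots,x_m;p)_k=(x_1;p)_k\cdots(x_m;p)_k$. The $q$-integer is $[m]=1+q+\cdots+q^{m-1}$ and $\Phi_n(q)$ is the $n$-th cyclotomic polynomial. For rational functions $A,B$ in $q,a,b$ and a polynomial $P$, $A\equiv B\pmod{P}$ means that the numerator of the reduced form of $A-B$ is divisible by $P$ in the polynomial ring over $\mathbb{Z}$ in these variables. *)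

theory Defs
  imports "HOL-Computational_Algebra.Computational_Algebra"
begin

definition primitive_roots_of_unity :: "nat \<Rightarrow> complex set" where
  "primitive_roots_of_unity n = {z. z ^ n = 1 \<and> (\<forall>m. 0 < m \<and> m < n \<longrightarrow> z ^ m \<noteq> 1)}"

definition cyclotomic_complex :: "nat \<Rightarrow> complex poly" where
  "cyclotomic_complex n = (\<Prod>z\<in>primitive_roots_of_unity n. [:- z, 1:])"

text \<open>
  The product over the primitive roots of unity has integer coefficients; the unique integer
  polynomial that it comes from is the cyclotomic polynomial. Existence and uniqueness are
  proved in \<open>of_int_cyclotomic_poly\<close> below.
\<close>

definition cyclotomic_poly :: "nat \<Rightarrow> int poly" where
  "cyclotomic_poly n = (THE p. map_poly of_int p = cyclotomic_complex n)"

lemma of_int_poly_add: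
  "map_poly of_int (p + q) = (map_poly of_int p + map_poly of_int q :: complex poly)"
  by (rule poly_eqI) (simp add: coeff_map_poly)

lemma of_int_poly_mult:
  "map_poly of_int (p * q) = (map_poly of_int p * map_poly of_int q :: complex poly)"
  by (rule poly_eqI) (simp add: coeff_map_poly coeff_mult)

lemma of_int_poly_prod:
  "map_poly of_int (\<Prod>x\<in>A. f x) = (\<Prod>x\<in>A. map_poly of_int (f x) :: complex poly)"
  by (induction A rule: infinite_finite_induct) (simp_all add: of_int_poly_mult)

lemma of_int_poly_inj:
  assumes "map_poly of_int p = (map_poly of_int q :: complex poly)"
  shows   "p = q"
proof (rule poly_eqI)
  fix i
  have "coeff (map_poly of_int p :: complex poly) i = coeff (map_poly of_int q) i"
    by (simp only: assms)
  thus "coeff p i = coeff q i" by (simp add: coeff_map_poly)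
qed

lemma lead_coeff_prod_linear: "lead_coeff (\<Prod>z\<in>A. [:- z, 1:] :: complex poly) = 1"
  by (simp add: lead_coeff_prod)

lemma prod_linear_roots_of_unity:
  assumes "n > 0"
  shows   "(\<Prod>z\<in>{z. z ^ n = 1}. [:- z, 1:]) = (monom 1 n - 1 :: complex poly)"
proof (rule poly_eqI_degree_lead_coeff[where A = "{z. z ^ n = 1}" and n = n])
  let ?P = "\<Prod>z\<in>{z. z ^ n = 1}. [:- z, 1:] :: complex poly"
  have card: "card {z :: complex. z ^ n = 1} = n"
    using assms by (rule card_roots_unity_eq)
  have fin: "finite {z :: complex. z ^ n = 1}"
    using assms finite_roots_unity[of n] by simp
  have deg: "degree ?P = n"
    by (subst degree_prod_eq_sum_degree) (simp_all add: card)
  have "coeff ?P n = 1"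
    using lead_coeff_prod_linear[of "{z. z ^ n = 1}"] deg by simp
  moreover have "coeff (monom 1 n - 1 :: complex poly) n = 1"
    using assms by simp
  ultimately show "coeff ?P n = coeff (monom 1 n - 1) n" by simp
  show "n \<le> card {z :: complex. z ^ n = 1}" using card by simp
  show "degree ?P \<le> n" using deg by simp
  show "degree (monom 1 n - 1 :: complex poly) \<le> n"
    by (intro degree_diff_le) (simp_all add: degree_monom_eq)
  fix z :: complex
  assume z: "z \<in> {z. z ^ n = 1}"
  have "poly ?P z = 0" using fin z by (auto simp: poly_prod)
  moreover have "poly (monom 1 n - 1) z = 0" using z by (simp add: poly_monom)
  ultimately show "poly ?P z = poly (monom 1 n - 1) z" by simp
qed

lemma roots_of_unity_partition:
  assumes "n > 0"
  shows   "{z :: complex. z ^ n = 1} = (\<Union>d\<in>{d. d dvd n}. primitive_roots_of_unity d)"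
proof (intro equalityI subsetI)
  fix z :: complex
  assume "z \<in> {z. z ^ n = 1}"
  hence z: "z ^ n = 1" by simp
  define d where "d = (LEAST m. 0 < m \<and> z ^ m = 1)"
  have d: "0 < d \<and> z ^ d = 1"
    unfolding d_def by (rule LeastI[of _ n]) (use assms z in auto)
  have min: "z ^ m \<noteq> 1" if "0 < m" "m < d" for m
    using not_less_Least[of m "\<lambda>m. 0 < m \<and> z ^ m = 1"] that by (auto simp: d_def)
  have "z ^ n = (z ^ d) ^ (n div d) * z ^ (n mod d)"
    by (simp flip: power_mult power_add)
  hence "z ^ (n mod d) = 1" using z d by simp
  hence "n mod d = 0" using min[of "n mod d"] d by fastforce
  hence "d dvd n" by auto
  thus "z \<in> (\<Union>d\<in>{d. d dvd n}. primitive_roots_of_unity d)"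
    using d min by (auto simp: primitive_roots_of_unity_def)
next
  fix z :: complex
  assume "z \<in> (\<Union>d\<in>{d. d dvd n}. primitive_roots_of_unity d)"
  thus "z \<in> {z. z ^ n = 1}"
    by (auto simp: primitive_roots_of_unity_def dvd_def power_mult)
qed

lemma prod_cyclotomic_complex:
  assumes "n > 0"
  shows   "(\<Prod>d\<in>{d. d dvd n}. cyclotomic_complex d) = monom 1 n - 1"
proof -
  have pos: "d > 0" if "d dvd n" for d
    using assms that by (rule dvd_pos_nat)
  have fin: "finite (primitive_roots_of_unity d)" if "d dvd n" for d
  proof (rule finite_subset)
    show "primitive_roots_of_unity d \<subseteq> {z. z ^ d = 1}"
      unfolding primitive_roots_of_unity_def by blast
    show "finite {z :: complex. z ^ d = 1}"
      using pos[OF that] by (rule finite_nth_roots)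
  qed
  have disj: "primitive_roots_of_unity d \<inter> primitive_roots_of_unity e = {}"
    if "d dvd n" "e dvd n" "d \<noteq> e" for d e
  proof (cases "d < e")
    case True
    thus ?thesis using pos[OF that(1)] unfolding primitive_roots_of_unity_def by blast
  next
    case False
    hence "e < d" using that(3) by simp
    thus ?thesis using pos[OF that(2)] unfolding primitive_roots_of_unity_def by blast
  qed
  have "(\<Prod>z\<in>{z. z ^ n = 1}. [:- z, 1:]) = (\<Prod>d\<in>{d. d dvd n}. cyclotomic_complex d)"
    unfolding cyclotomic_complex_def roots_of_unity_partition[OF assms]
  proof (rule prod.UNION_disjoint)
    show "finite {d. d dvd n}" using assms by simp
    show "\<forall>d\<in>{d. d dvd n}. finite (primitive_roots_of_unity d)"
      using fin by simp
    show "\<forall>d\<in>{d. d dvd n}. \<forall>e\<in>{d. d dvd n}. d \<noteq> e \<longrightarrow>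
            primitive_roots_of_unity d \<inter> primitive_roots_of_unity e = {}"
      using disj by simp
  qed
  thus ?thesis using prod_linear_roots_of_unity[OF assms] by simp
qed

lemma ex_int_poly_cyclotomic_complex:
  assumes "n > 0"
  shows   "\<exists>p :: int poly. map_poly of_int p = cyclotomic_complex n"
  using assms
proof (induction n rule: less_induct)
  case (less n)
  have "\<exists>p :: int poly. map_poly of_int p = cyclotomic_complex d"
    if "d dvd n" "d \<noteq> n" for d
  proof (rule less.IH)
    show "d < n" using dvd_imp_le[OF that(1) less.prems] that(2) by simp
    show "0 < d" using less.prems that(1) by (rule dvd_pos_nat)
  qed
  hence "\<forall>d. \<exists>p :: int poly. d dvd n \<and> d \<noteq> n \<longrightarrow> map_poly of_int p = cyclotomic_complex d"
    by blast
  from choice[OF this] obtain f :: "nat \<Rightarrow> int poly"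
    where f: "map_poly of_int (f d) = cyclotomic_complex d" if "d dvd n" "d \<noteq> n" for d
    by blast
  define D where "D = (\<Prod>d\<in>{d. d dvd n} - {n}. f d)"
  let ?D = "map_poly of_int D :: complex poly"
  have D: "?D = (\<Prod>d\<in>{d. d dvd n} - {n}. cyclotomic_complex d)"
    unfolding D_def of_int_poly_prod by (rule prod.cong) (auto simp: f)
  have "of_int (lead_coeff D) = lead_coeff ?D"
    by (simp add: degree_map_poly coeff_map_poly)
  also have "\<dots> = 1"
    unfolding D by (simp add: lead_coeff_prod cyclotomic_complex_def)
  finally have lc: "lead_coeff D = 1" by (simp only: of_int_eq_1_iff)
  hence D0: "D \<noteq> 0" by auto
  have degD: "degree ?D = degree D" by (simp add: degree_map_poly)
  obtain q r where qr: "pseudo_divmod (monom 1 n - 1) D = (q, r)"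
    by (cases "pseudo_divmod (monom 1 n - 1) D")
  have eq: "monom 1 n - 1 = D * q + r" and r: "r = 0 \<or> degree r < degree D"
    using pseudo_divmod[OF D0 qr] lc by simp_all
  have "(monom 1 n - 1 :: complex poly) = map_poly of_int (monom 1 n - 1)"
    by (rule poly_eqI) (simp add: coeff_map_poly)
  also have "\<dots> = ?D * map_poly of_int q + map_poly of_int r"
    unfolding eq by (simp add: of_int_poly_add of_int_poly_mult)
  finally have "monom 1 n - 1 = ?D * map_poly of_int q + map_poly of_int r" .
  moreover have "monom 1 n - 1 = cyclotomic_complex n * ?D"
    unfolding D using prod_cyclotomic_complex[OF less.prems] less.prems
    by (subst (asm) prod.remove[where x = n]) auto
  ultimately have *: "?D * (cyclotomic_complex n - map_poly of_int q) = map_poly of_int r"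
    by (simp add: algebra_simps)
  have "(map_poly of_int r :: complex poly) = 0"
  proof (rule ccontr)
    assume nz: "(map_poly of_int r :: complex poly) \<noteq> 0"
    hence "degree ?D \<le> degree (map_poly of_int r :: complex poly)"
      by (intro dvd_imp_degree_le) (auto simp flip: *)
    with degD r nz show False by (auto simp: degree_map_poly)
  qed
  moreover have "?D \<noteq> 0" using D0 by (simp add: map_poly_eq_0_iff)
  ultimately have "map_poly of_int q = cyclotomic_complex n" using * by simp
  thus ?case by blast
qed

lemma of_int_cyclotomic_poly:
  assumes "n > 0"
  shows   "map_poly of_int (cyclotomic_poly n) = cyclotomic_complex n"
proof -
  obtain p :: "int poly" where p: "map_poly of_int p = cyclotomic_complex n"
    using ex_int_poly_cyclotomic_complex[OF assms] by blast
  have "cyclotomic_poly n = p"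
    unfolding cyclotomic_poly_def
    by (rule the_equality) (rule p, rule of_int_poly_inj, simp only: p)
  thus ?thesis using p by simp
qed

definition q_integer :: "'a::comm_ring_1 \<Rightarrow> nat \<Rightarrow> 'a" where
  "q_integer q m = (\<Sum>i<m. q ^ i)"

definition q_poch :: "'a::comm_ring_1 \<Rightarrow> 'a \<Rightarrow> nat \<Rightarrow> 'a" where
  "q_poch x p k = (\<Prod>j<k. 1 - x * p ^ j)"

definition q_poch_list :: "'a::comm_ring_1 list \<Rightarrow> 'a \<Rightarrow> nat \<Rightarrow> 'a" where
  "q_poch_list xs p k = (\<Prod>x\<leftarrow>xs. q_poch x p k)"

text \<open>
  The polynomial ring in three indeterminates over the integers is the iterated polynomial ring,
  with \<open>q\<close> innermost and \<open>b\<close> outermost. It is a factorial ring, so every element of its fraction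
  field has a reduced form, given by \<open>quot_of_fract\<close>.
\<close>

type_synonym qab_poly = "int poly poly poly"
type_synonym qab_ratfun = "qab_poly fract"

definition indet_q :: qab_poly where "indet_q = [:[:[:0, 1:]:]:]"
definition indet_a :: qab_poly where "indet_a = [:[:0, 1:]:]"
definition indet_b :: qab_poly where "indet_b = [:0, 1:]"

definition poly_in_q :: "int poly \<Rightarrow> qab_poly" where
  "poly_in_q p = [:[:p:]:]"

definition ratfun_cong :: "qab_ratfun \<Rightarrow> qab_ratfun \<Rightarrow> qab_poly \<Rightarrow> bool" where
  "ratfun_cong A B P \<longleftrightarrow> P dvd fst (quot_of_fract (A - B))"

end

theory Submission
  imports Defs
begin

text \<open>
  A polynomial in \<open>q, a, b\<close> is divisible by the modulus as soon as it vanishes at enough complex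
  points with \<open>a = q\<^sup>n\<close>, with \<open>a = q\<^sup>-\<^sup>n\<close>, and with \<open>q\<close> a primitive \<open>n\<close>-th root of unity; evaluation
  carries over to the rational functions because no denominator vanishes there.

  For \<open>a = q\<^sup>-\<^sup>n\<close> the two sides agree by Watson's transformation of a terminating very-well-poised
  \<open>8\<phi>7\<close> into a balanced \<open>4\<phi>3\<close>, in base \<open>q\<^sup>2\<close>; both sides are invariant under \<open>a \<mapsto> 1/a\<close>, which settles
  \<open>a = q\<^sup>n\<close>. At a primitive root of unity \<open>[n]\<close> vanishes, and so does the left-hand side, whose \<open>k\<close>-th
  and \<open>((n - 1)/2 - k)\<close>-th terms cancel.
\<close>

subsection \<open>Terminating basic hypergeometric sums\<close>

text \<open>Setting a = q^-n is what makes Watson's series terminate: for n = 2N + 1 and p = q^2 the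
  parameter aq satisfies aq p^N = 1, and N is exactly the upper bound of both sums. Each
  hypergeometric identity is reduced to a first-order recurrence whose certificate becomes a
  polynomial identity after clearing denominators.

  The obstacle lies in passing from numbers to indeterminates: a rational function has no value
  where its denominator vanishes, and its reduced numerator is not explicit. The points are
  therefore selected by absolute value: |q| > 1 and 0 < |b| < 1 in the generic case, and 0 < |a| <
  1, 0 < |b| < 1 at roots of unity, where |q| = 1. These regions leave infinitely many choices for
  the free variables and keep every denominator away from 0. Divisibility over the integers, not
  merely over a field, is recovered because every factor of the modulus allows division without
  fractions: a - q^n is monic in a, 1 - a q^n has constant term 1 in a, and the cyclotomic
  polynomial is monic in q.\<close>

lemma q_poch_0 [simp]: "q_poch x p 0 = 1"
  by (simp add: q_poch_def)

lemma q_poch_Suc: "q_poch x p (Suc k) = q_poch x p k * (1 - x * p ^ k)"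
  by (simp add: q_poch_def)

lemma q_poch_add: "q_poch x p (m + k) = q_poch x p m * q_poch (x * p ^ m) p k"
  by (induction k) (simp_all add: q_poch_Suc power_add mult_ac)

lemma q_poch_Suc_left: "q_poch x p (Suc k) = (1 - x) * q_poch (x * p) p k"
  using q_poch_add[of x p 1 k] by (simp add: q_poch_Suc)

lemma q_poch_eq_0: "x * p ^ j = 1 \<Longrightarrow> j < k \<Longrightarrow> q_poch x p k = 0"
  by (auto simp: q_poch_def intro!: prod_zero)

lemma q_poch_nonzero:
  fixes x p :: "'a::idom"
  assumes "\<And>j. j < k \<Longrightarrow> x * p ^ j \<noteq> 1"
  shows "q_poch x p k \<noteq> 0"
  using assms by (auto simp: q_poch_def)

lemma q_poch_nonzero_le:
  fixes x p :: "'a::idom"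
  shows "q_poch x p k \<noteq> 0 \<Longrightarrow> j \<le> k \<Longrightarrow> q_poch x p j \<noteq> 0"
  by (auto simp: q_poch_def)

text \<open>Reversing the product pairs the arguments \<open>x * p ^ i\<close> and
  \<open>y * p ^ (k - Suc i)\<close>. They are reciprocal, and 1 - u = (1 - 1/u)(-u).\<close>

lemma q_poch_reflect:
  fixes x y p :: "'a::field"
  assumes "y * x * p ^ k = p" "p \<noteq> 0"
  shows "q_poch x p k = q_poch y p k * (- x) ^ k * (\<Prod>i<k. p ^ i)"
proof -
  have eq: "y * p ^ (k - Suc i) * (x * p ^ i) = 1" if "i < k" for i
  proof -
    have "p ^ k = p ^ (k - Suc i) * p ^ i * p"
      using that by (simp flip: power_add power_Suc2)
    thus ?thesis using assms by (simp add: mult_ac)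
  qed
  have "q_poch x p k = (\<Prod>i<k. (1 - y * p ^ (k - Suc i)) * (- x * p ^ i))"
    unfolding q_poch_def by (intro prod.cong refl) (use eq in \<open>simp add: algebra_simps\<close>)
  also have "\<dots> = (\<Prod>i<k. 1 - y * p ^ (k - Suc i)) * ((- x) ^ k * (\<Prod>i<k. p ^ i))"
    by (simp add: prod.distrib del: mult_minus_left mult_minus_right)
  also have "(\<Prod>i<k. 1 - y * p ^ (k - Suc i)) = q_poch y p k"
    unfolding q_poch_def by (rule prod.nat_diff_reindex)
  finally show ?thesis by (simp add: mult_ac)
qed

section \<open>The \<open>q\<close>-Saalschuetz sum\<close>

text \<open>This is the induction step of the telescoping sum with common factors removed; x stands
  for p^k and y for p^m. The bracket on the right is numerator minus denominator of the ratio of two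
  consecutive closed forms, apart from the constant factor 1 - A p x^2.\<close>

lemma saalschuetz_certificate:
  fixes A B C p x y :: "'a::field"
  assumes "B \<noteq> 0" "C \<noteq> 0" "p \<noteq> 0" "x \<noteq> 0"
  shows "(1 - A*p*x/B) * (1 - A*p*x/C) * (1 - A*p*x*y) * (1 - 1/(p*x)) * (p*y)
      - (1 - B*x) * (1 - C*x) * (A*p/(B*C)) * (1 - A*x) * (1 - y/x) * (p*y)
    = (1 - A*p*x^2) * ((1 - A*p/(B*C)*(p*y)) * (1 - A*p*x*y) * (1 - y/x)
        - (1 - p*y) * (1 - A*p/B*y) * (1 - A*p/C*y))"
  using assms by (simp add: divide_simps power2_eq_square) algebra

text \<open>
  The Wilf--Zeilberger method: with \<open>x = p\<^sup>k\<close> the summand on the left is \<open>w (k + 1) j\<close> minus a multiple of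
  \<open>w k j\<close>, and it telescopes in \<open>j\<close>.
\<close>

lemma saalschuetz_partial_sum:
  fixes A B C p x :: "'a::field"
  defines "s \<equiv> A * p / (B * C)"
  defines "d \<equiv> \<lambda>j. q_poch p p j * q_poch (A*p/B) p j * q_poch (A*p/C) p j"
  defines "w \<equiv> \<lambda>x j. q_poch s p j * q_poch (A*x) p j * q_poch (1/x) p j * p ^ j / d j"
  assumes nz: "B \<noteq> 0" "C \<noteq> 0" "p \<noteq> 0" "x \<noteq> 0" and d: "d m \<noteq> 0"
  shows "(\<Sum>j\<le>m. (1 - A*p*x/B) * (1 - A*p*x/C) * w (p*x) j - (1 - B*x) * (1 - C*x) * s * w x j)
    = (1 - A*p*x^2) * q_poch s p (Suc m) * q_poch (A*p*x) p m * q_poch (1/x) p m / d m"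
  using d
proof (induction m)
  case 0
  show ?case using nz 
    by (simp add: w_def d_def s_def q_poch_Suc divide_simps power2_eq_square) algebra
next
  case (Suc m)
  define y where "y = p ^ m"
  define D where "D = (1 - p*y) * (1 - A*p/B*y) * (1 - A*p/C*y)"
  define U where "U = q_poch s p (Suc m) * q_poch (A*p*x) p m * q_poch (1/x) p m"
  have dS: "d (Suc m) = d m * D"
    by (simp add: d_def D_def q_poch_Suc y_def mult_ac)
  with Suc.prems have dm: "d m \<noteq> 0" and D: "D \<noteq> 0" by auto
  have px: "1 / (p * x) * p = 1 / x" using nz by simp
  \<comment> \<open>Both new summands contain \<open>U\<close>: the shift from x to p x is absorbed
    by splitting off the first factor of the symbol at 1/(p x) here, and of the one at A x in
    \<open>w2\<close>.\<close>
  have w1: "w (p*x) (Suc m) = U / d m * ((1 - A*p*x*y) * (1 - 1/(p*x)) * (p*y)) / D"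
    unfolding w_def U_def dS q_poch_Suc_left[of "1/(p*x)"] px q_poch_Suc[of "A*(p*x)"]
    by (simp add: y_def mult_ac)
  have w2: "w x (Suc m) = U / d m * ((1 - A*x) * (1 - y/x) * (p*y)) / D"
    unfolding w_def U_def dS q_poch_Suc_left[of "A*x"] q_poch_Suc[of "1/x"]
    by (simp add: y_def mult_ac)
  have IH: "(\<Sum>j\<le>m. (1 - A*p*x/B) * (1 - A*p*x/C) * w (p*x) j - (1 - B*x) * (1 - C*x) * s * w x j)
      = (1 - A*p*x^2) * U / d m"
    using Suc.IH[OF dm] by (simp add: U_def mult_ac)
  have factor: "e1 * (V * t1 / D) - e2 * (V * t2 / D) = V / D * (e1 * t1 - e2 * t2)"
    for e1 e2 t1 t2 V :: 'a
    by (simp add: diff_divide_distrib algebra_simps)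
  have factor': "c * U / d m + U / d m / D * (c * (t - D)) = c * U * t / (d m * D)" for c t
    using dm D by (simp add: field_simps)
  have "(\<Sum>j\<le>Suc m. (1 - A*p*x/B) * (1 - A*p*x/C) * w (p*x) j - (1 - B*x) * (1 - C*x) * s * w x j)
      = (1 - A*p*x^2) * U / d m + U / d m / D *
         ((1 - A*p*x/B) * (1 - A*p*x/C) * (1 - A*p*x*y) * (1 - 1/(p*x)) * (p*y)
         - (1 - B*x) * (1 - C*x) * s * (1 - A*x) * (1 - y/x) * (p*y))"
    unfolding sum.atMost_Suc IH w1 w2 factor by (simp only: mult.assoc)
  also have "(1 - A*p*x/B) * (1 - A*p*x/C) * (1 - A*p*x*y) * (1 - 1/(p*x)) * (p*y)
         - (1 - B*x) * (1 - C*x) * s * (1 - A*x) * (1 - y/x) * (p*y)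
      = (1 - A*p*x^2) * ((1 - s*(p*y)) * (1 - A*p*x*y) * (1 - y/x) - D)"
    unfolding D_def s_def by (rule saalschuetz_certificate) (use nz in auto)
  also have "(1 - A*p*x^2) * U / d m + U / d m / D * \<dots>
      = (1 - A*p*x^2) * U * ((1 - s*(p*y)) * (1 - A*p*x*y) * (1 - y/x)) / (d m * D)"
    using factor' .
  also have "\<dots> = (1 - A*p*x^2) * q_poch s p (Suc (Suc m)) * q_poch (A*p*x) p (Suc m) *
      q_poch (1/x) p (Suc m) / d (Suc m)"
    unfolding dS U_def q_poch_Suc[of s p "Suc m"] q_poch_Suc[of "A*p*x"] q_poch_Suc[of "1/x"]
    by (simp add: y_def mult_ac)
  finally show ?case .
qed

text \<open>For x = p^k and m = k + 1 the telescoped sum contains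
  \<open>q_poch (1/p^k) p (Suc k)\<close>, which is 0, so the sum for k + 1 is an explicit multiple
  of the sum for k. The parameters are arranged so that the right-hand side is the part of Watson's
  summand that involves B and C.\<close>

lemma q_saalschuetz:
  fixes A B C p :: "'a::field"
  defines "s \<equiv> A * p / (B * C)"
  assumes nz: "B \<noteq> 0" "C \<noteq> 0" "p \<noteq> 0"
    and d: "q_poch p p k * q_poch (A*p/B) p k * q_poch (A*p/C) p k \<noteq> 0"
  shows "(\<Sum>j\<le>k. q_poch s p j * q_poch (A*p^k) p j * q_poch (1/p^k) p j * p ^ j
            / (q_poch p p j * q_poch (A*p/B) p j * q_poch (A*p/C) p j))
    = q_poch B p k * q_poch C p k * s ^ k / (q_poch (A*p/B) p k * q_poch (A*p/C) p k)"
  using d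
proof (induction k)
  case 0
  show ?case by simp
next
  case (Suc k)
  define w where "w = (\<lambda>x j. q_poch s p j * q_poch (A*x) p j * q_poch (1/x) p j * p ^ j
      / (q_poch p p j * q_poch (A*p/B) p j * q_poch (A*p/C) p j))"
  define e where "e = (1 - A*p*p^k/B) * (1 - A*p*p^k/C)"
  have dk: "q_poch p p k * q_poch (A*p/B) p k * q_poch (A*p/C) p k \<noteq> 0" and e: "e \<noteq> 0"
    using Suc.prems by (auto simp: q_poch_Suc e_def)
  have 0: "q_poch (1/p^k) p (Suc k) = 0"
    by (rule q_poch_eq_0[of _ _ k]) (use nz in auto)
  have "(\<Sum>j\<le>Suc k. e * w (p*p^k) j - (1 - B*p^k) * (1 - C*p^k) * s * w (p^k) j) = 0"
    unfolding e_def w_def s_def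
    by (subst saalschuetz_partial_sum) (use nz Suc.prems 0 in auto)
  hence "e * (\<Sum>j\<le>Suc k. w (p^Suc k) j) = (1 - B*p^k) * (1 - C*p^k) * s * (\<Sum>j\<le>Suc k. w (p^k) j)"
    by (simp add: sum_subtractf flip: sum_distrib_left)
  also have "(\<Sum>j\<le>Suc k. w (p^k) j) = (\<Sum>j\<le>k. w (p^k) j)"
    by (simp add: w_def 0)
  also have "\<dots> = q_poch B p k * q_poch C p k * s ^ k / (q_poch (A*p/B) p k * q_poch (A*p/C) p k)"
    using Suc.IH[OF dk] by (simp add: w_def)
  finally have "e * (\<Sum>j\<le>Suc k. w (p^Suc k) j) = \<dots> * ((1 - B*p^k) * (1 - C*p^k) * s)" 
    by (simp add: mult_ac)
  hence "(\<Sum>j\<le>Suc k. w (p^Suc k) j) = q_poch B p k * q_poch C p k * s ^ k / (q_poch (A*p/B) p k * q_poch (A*p/C) p k)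
      * ((1 - B*p^k) * (1 - C*p^k) * s) / e"
    using e by (metis nonzero_mult_div_cancel_left)
  also have "\<dots> = q_poch B p (Suc k) * q_poch C p (Suc k) * s ^ Suc k / (q_poch (A*p/B) p (Suc k) * q_poch (A*p/C) p (Suc k))"
    by (simp add: q_poch_Suc e_def mult_ac)
  finally show ?case by (simp add: w_def)
qed

section \<open>Very-well-poised sums and Watson's transformation\<close>

text \<open>With x = p^k and y = p^j, the left side is the coefficient of \<open>v j k\<close> in
  the summand below. The two terms on the right are the closed forms of the partial sums up to k and
  k - 1, the latter rewritten as a multiple of \<open>v j k\<close>.\<close>

lemma very_well_poised_certificate:
  fixes A D E F p x y :: "'a::field"
  assumes "A \<noteq> 0" "D \<noteq> 0" "E \<noteq> 0" "F \<noteq> 0" "x \<noteq> 0"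
  shows "(1 - A*x^2) * ((1 - D*E*F/A*y) * (1 - A*x*y) * (1 - y/x) - (1 - D*y) * (1 - E*y) * (1 - F*y))
    = - (y/x) * (1 - A*x*y) * (1 - D*x) * (1 - E*x) * (1 - F*x) 
      - y * (1 - y/x) * (D*E*F/A) * (1 - A*x/D) * (1 - A*x/E) * (1 - A*x/F)"
  using assms by (simp add: divide_simps power2_eq_square) algebra

text \<open>
  The factor \<open>(p\<^sup>-\<^sup>k; p)\<^sub>j\<close> in \<open>v j k\<close> makes the sum over \<open>k\<close> start effectively at \<open>k = j\<close>. A relation between
  the sums for \<open>j\<close> and \<open>j + 1\<close> telescopes in \<open>k\<close>.
\<close>

lemma very_well_poised_partial_sum:
  fixes A D E F p :: "'a::field" and j :: nat
  defines "z \<equiv> A * p / (D * E * F)" and "y \<equiv> p ^ j"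
  defines "d \<equiv> \<lambda>k. q_poch p p k * q_poch (A*p/D) p k * q_poch (A*p/E) p k * q_poch (A*p/F) p k"
  defines "v \<equiv> \<lambda>j k. q_poch A p k * q_poch D p k * q_poch E p k * q_poch F p k * z ^ k
      * (q_poch (A*p^k) p j * q_poch (1/p^k) p j) / d k"
  assumes nz: "A \<noteq> 0" "D \<noteq> 0" "E \<noteq> 0" "F \<noteq> 0" "p \<noteq> 0" and d: "d m \<noteq> 0"
  shows "(\<Sum>k\<le>m. (1 - A*p^(2*k)) * ((1 - D*E*F/A*y) * v (Suc j) k
        - (1 - D*y) * (1 - E*y) * (1 - F*y) * v j k))
    = - (y/p^m) * (1 - A*p^m*y) * (1 - D*p^m) * (1 - E*p^m) * (1 - F*p^m) * v j m"
  using d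
proof (induction m)
  case 0
  show ?case
  proof (cases j)
    case 0
    thus ?thesis using nz by (simp add: v_def d_def y_def q_poch_Suc algebra_simps)
  next
    case (Suc i)
    hence "q_poch 1 p j = 0" by (intro q_poch_eq_0[of _ _ 0]) auto
    thus ?thesis by (simp add: v_def q_poch_Suc)
  qed
next
  case (Suc m)
  define x where "x = p ^ m"
  define T where "T = (1 - A*(p*x)/D) * (1 - A*(p*x)/E) * (1 - A*(p*x)/F)"
  have x: "x \<noteq> 0" using nz by (simp add: x_def)
  have dS: "d (Suc m) = d m * ((1 - p*x) * T)"
    by (simp add: d_def q_poch_Suc T_def x_def mult_ac)
  with Suc.prems have dm: "d m \<noteq> 0" and px: "1 - p*x \<noteq> 0" and T: "T \<noteq> 0" by auto
  have vS: "v (Suc j) k = v j k * ((1 - A*p^k*y) * (1 - y/p^k))" for k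
    unfolding v_def q_poch_Suc[of _ _ j] by (simp add: y_def)
  have 1: "(1 - A*x) * q_poch (A*(p*x)) p j = q_poch (A*x) p j * (1 - A*x*y)"
    using q_poch_Suc_left[of "A*x" p j] q_poch_Suc[of "A*x" p j] by (simp add: y_def mult_ac)
  have 2: "q_poch (1/(p*x)) p j * (1 - y/(p*x)) = (1 - 1/(p*x)) * q_poch (1/x) p j"
    using q_poch_Suc_left[of "1/(p*x)" p j] q_poch_Suc[of "1/(p*x)" p j] nz
    by (simp add: y_def mult_ac)
  have r: "(1 - 1/(p*x)) / ((1 - p*x) * T) = - 1 / (p*x*T)"
    using px T nz x by (simp add: divide_simps)
  \<comment> \<open>At j = m + 1 the term \<open>v j m\<close> is 0 and has no usable ratio to
    \<open>v j (Suc m)\<close>. The factor 1 - y/(p x) vanishes there as well, so keeping it on the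
    left gives a relation valid for every j.\<close>
  have "v j (Suc m) * (1 - y/(p*x)) = q_poch A p m * q_poch D p m * q_poch E p m * q_poch F p m
      * z ^ m * z * (1 - D*x) * (1 - E*x) * (1 - F*x) * (((1 - A*x) * q_poch (A*(p*x)) p j) *
        (q_poch (1/(p*x)) p j * (1 - y/(p*x)))) / (d m * ((1 - p*x) * T))"
    unfolding v_def dS q_poch_Suc[of _ _ m] by (simp add: x_def mult_ac)
  also have "\<dots> = v j m * (1 - A*x*y) * (1 - D*x) * (1 - E*x) * (1 - F*x) * z * (1 - 1/(p*x)) / ((1 - p*x) * T)"
    unfolding 1 2 v_def by (simp add: x_def mult_ac)
  also have "\<dots> = v j m * (1 - A*x*y) * (1 - D*x) * (1 - E*x) * (1 - F*x) * z * (- 1 / (p*x*T))"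
    using r by (metis times_divide_eq_right)
  finally have "v j (Suc m) * (1 - y/(p*x)) * (p*x*T) = 
      - (v j m * (1 - A*x*y) * (1 - D*x) * (1 - E*x) * (1 - F*x) * z)"
    using T x nz by (simp add: divide_simps)
  hence H: "- (y/x) * (1 - A*x*y) * (1 - D*x) * (1 - E*x) * (1 - F*x) * v j m
      = v j (Suc m) * (y * (1 - y/(p*x)) * (D*E*F/A) * T)"
    using nz x by (simp add: z_def divide_simps) algebra
  have pw: "p ^ (2 * Suc m) = (p*x)^2"
    by (simp only: x_def power_mult mult.commute[of 2] power_Suc)
  have factor: "V * X + P * (Q * (V * R) - t * V) = V * (X + P * (Q * R - t))"
    for V X P Q R t :: 'a
    by algebra
  have "(\<Sum>k\<le>Suc m. (1 - A*p^(2*k)) * ((1 - D*E*F/A*y) * v (Suc j) k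
        - (1 - D*y) * (1 - E*y) * (1 - F*y) * v j k)) =
      v j (Suc m) * (y * (1 - y/(p*x)) * (D*E*F/A) * T) +
      (1 - A*p^(2*Suc m)) * ((1 - D*E*F/A*y) * v (Suc j) (Suc m)
        - (1 - D*y) * (1 - E*y) * (1 - F*y) * v j (Suc m))"
    using Suc.IH[OF dm] H by (simp add: x_def)
  also have "\<dots> = v j (Suc m) * (y * (1 - y/(p*x)) * (D*E*F/A) * T + 
      (1 - A*(p*x)^2) * ((1 - D*E*F/A*y) * (1 - A*(p*x)*y) * (1 - y/(p*x)) - (1 - D*y) * (1 - E*y) * (1 - F*y)))"
    unfolding vS pw factor by (simp add: x_def)
  also have "(1 - A*(p*x)^2) * ((1 - D*E*F/A*y) * (1 - A*(p*x)*y) * (1 - y/(p*x)) - (1 - D*y) * (1 - E*y) * (1 - F*y))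
    = - (y/(p*x)) * (1 - A*(p*x)*y) * (1 - D*(p*x)) * (1 - E*(p*x)) * (1 - F*(p*x)) 
      - y * (1 - y/(p*x)) * (D*E*F/A) * (1 - A*(p*x)/D) * (1 - A*(p*x)/E) * (1 - A*(p*x)/F)"
    by (rule very_well_poised_certificate) (use nz x in auto)
  finally show ?case by (simp add: T_def x_def mult_ac)
qed

text \<open>Since F p^N = 1, the closed form at m = N contains the factor 1 - F p^N = 0. What
  remains is a two-term recurrence in j, iterated here down to j = 0. It stays in multiplied form
  because \<open>q_poch (D*E*F/A) p j\<close> may vanish.\<close>

lemma very_well_poised_sum_recurrence:
  fixes A D E F p :: "'a::field"
  defines "z \<equiv> A * p / (D * E * F)"
  defines "d \<equiv> \<lambda>k. q_poch p p k * q_poch (A*p/D) p k * q_poch (A*p/E) p k * q_poch (A*p/F) p k"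
  defines "v \<equiv> \<lambda>j k. q_poch A p k * q_poch D p k * q_poch E p k * q_poch F p k * z ^ k
      * (q_poch (A*p^k) p j * q_poch (1/p^k) p j) / d k"
  assumes nz: "A \<noteq> 0" "D \<noteq> 0" "E \<noteq> 0" "p \<noteq> 0" and F: "F * p ^ N = 1" and d: "d N \<noteq> 0"
  shows "q_poch (D*E*F/A) p j * (\<Sum>k\<le>N. (1 - A*p^(2*k)) * v j k)
    = q_poch D p j * q_poch E p j * q_poch F p j * (\<Sum>k\<le>N. (1 - A*p^(2*k)) * v 0 k)"
proof (induction j)
  case 0
  show ?case by simp
next
  case (Suc j)
  define S where "S = (\<lambda>j. \<Sum>k\<le>N. (1 - A*p^(2*k)) * v j k)"
  have combine: "P * c * S' = P1 * r1 * (P2 * r2) * (P3 * r3) * S0"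
    if "c * S' = r1 * r2 * r3 * S" "P * S = P1 * P2 * P3 * S0" for c S' S S0 P P1 P2 P3 r1 r2 r3 :: 'a
    using that by algebra
  have "F \<noteq> 0" using F by auto
  from very_well_poised_partial_sum[where A=A and D=D and E=E and F=F and p=p and j=j and m=N]
  have "(\<Sum>k\<le>N. (1 - A*p^(2*k)) * ((1 - D*E*F/A*p^j) * v (Suc j) k
        - (1 - D*p^j) * (1 - E*p^j) * (1 - F*p^j) * v j k)) = 0"
    using nz d \<open>F \<noteq> 0\<close> F by (simp add: v_def d_def z_def)
  also have "(\<Sum>k\<le>N. (1 - A*p^(2*k)) * ((1 - D*E*F/A*p^j) * v (Suc j) k
        - (1 - D*p^j) * (1 - E*p^j) * (1 - F*p^j) * v j k)) =
     (1 - D*E*F/A*p^j) * S (Suc j) - (1 - D*p^j) * (1 - E*p^j) * (1 - F*p^j) * S j"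
    unfolding S_def sum_distrib_left sum_subtractf[symmetric]
    by (intro sum.cong refl) (simp only: right_diff_distrib mult.left_commute)
  finally have "(1 - D*E*F/A*p^j) * S (Suc j) = (1 - D*p^j) * (1 - E*p^j) * (1 - F*p^j) * S j"
    by simp
  moreover have "q_poch (D*E*F/A) p j * S j = q_poch D p j * q_poch E p j * q_poch F p j * S 0"
    using Suc.IH by (simp add: S_def)
  ultimately have "q_poch (D*E*F/A) p (Suc j) * S (Suc j)
      = q_poch D p (Suc j) * q_poch E p (Suc j) * q_poch F p (Suc j) * S 0"
    unfolding q_poch_Suc by (rule combine)
  thus ?case by (simp add: S_def)
qed

text \<open>
  Expand the factors containing \<open>B\<close> and \<open>C\<close> by the \<open>q\<close>-Saalschuetz sum and interchange the summations.
\<close>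

lemma watson_8phi7:
  fixes A B C D E F p :: "'a::field"
  assumes nz: "A \<noteq> 0" "B \<noteq> 0" "C \<noteq> 0" "D \<noteq> 0" "E \<noteq> 0" "p \<noteq> 0" and F: "F * p ^ N = 1"
    and d: "q_poch p p N \<noteq> 0" "q_poch (A*p/B) p N \<noteq> 0" "q_poch (A*p/C) p N \<noteq> 0"
      "q_poch (A*p/D) p N \<noteq> 0" "q_poch (A*p/E) p N \<noteq> 0" "q_poch (A*p/F) p N \<noteq> 0"
      "q_poch (D*E*F/A) p N \<noteq> 0"
  shows "(\<Sum>k\<le>N. (1 - A*p^(2*k)) * (q_poch A p k * q_poch B p k * q_poch C p k * q_poch D p k
        * q_poch E p k * q_poch F p k) / (q_poch p p k * q_poch (A*p/B) p k * q_poch (A*p/C) p k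
        * q_poch (A*p/D) p k * q_poch (A*p/E) p k * q_poch (A*p/F) p k)
        * (A^2 * p^2 / (B*C*D*E*F)) ^ k)
    = (\<Sum>k\<le>N. (1 - A*p^(2*k)) * (q_poch A p k * q_poch D p k * q_poch E p k * q_poch F p k)
        / (q_poch p p k * q_poch (A*p/D) p k * q_poch (A*p/E) p k * q_poch (A*p/F) p k)
        * (A*p / (D*E*F)) ^ k)
      * (\<Sum>j\<le>N. q_poch (A*p/(B*C)) p j * q_poch D p j * q_poch E p j * q_poch F p j
        / (q_poch p p j * q_poch (A*p/B) p j * q_poch (A*p/C) p j * q_poch (D*E*F/A) p j) * p ^ j)"
    (is "?L = ?S * ?R")
proof -
  define z where "z = A * p / (D * E * F)"
  define s where "s = A * p / (B * C)"
  define d where "d = (\<lambda>k. q_poch p p k * q_poch (A*p/D) p k * q_poch (A*p/E) p k * q_poch (A*p/F) p k)"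
  define v where "v = (\<lambda>j k. q_poch A p k * q_poch D p k * q_poch E p k * q_poch F p k * z ^ k
      * (q_poch (A*p^k) p j * q_poch (1/p^k) p j) / d k)"
  define c where "c = (\<lambda>j. q_poch s p j * p ^ j / (q_poch p p j * q_poch (A*p/B) p j * q_poch (A*p/C) p j))"
  have dN: "d N \<noteq> 0" using d by (simp add: d_def)
  have S: "(\<Sum>k\<le>N. (1 - A*p^(2*k)) * v 0 k) = ?S"
    by (intro sum.cong refl) (simp add: v_def d_def z_def)
  have rec: "(\<Sum>k\<le>N. (1 - A*p^(2*k)) * v j k)
      = q_poch D p j * q_poch E p j * q_poch F p j / q_poch (D*E*F/A) p j * ?S" if "j \<le> N" for j
  proof -
    have "q_poch (D*E*F/A) p j * (\<Sum>k\<le>N. (1 - A*p^(2*k)) * v j k)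
      = q_poch D p j * q_poch E p j * q_poch F p j * (\<Sum>k\<le>N. (1 - A*p^(2*k)) * v 0 k)"
      unfolding v_def d_def z_def by (rule very_well_poised_sum_recurrence) (use nz F dN in \<open>auto simp: d_def\<close>)
    moreover have "q_poch (D*E*F/A) p j \<noteq> 0"
      using d(7) that by (rule q_poch_nonzero_le)
    ultimately show ?thesis unfolding S by (simp add: field_simps)
  qed
  have inner: "(\<Sum>j\<le>N. c j * v j k) = v 0 k * (q_poch B p k * q_poch C p k * s ^ k
      / (q_poch (A*p/B) p k * q_poch (A*p/C) p k))" if "k \<le> N" for k
  proof -
    have "(\<Sum>j\<le>N. c j * v j k) = (\<Sum>j\<le>k. c j * v j k)"
    proof (rule sum.mono_neutral_right)
      show "\<forall>j\<in>{..N} - {..k}. c j * v j k = 0"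
      proof
        fix j assume "j \<in> {..N} - {..k}"
        hence "q_poch (1/p^k) p j = 0"
          using nz by (intro q_poch_eq_0[of _ _ k]) auto
        thus "c j * v j k = 0" by (simp add: v_def)
      qed
    qed (use that in auto)
    also have "\<dots> = v 0 k * (\<Sum>j\<le>k. q_poch s p j * q_poch (A*p^k) p j * q_poch (1/p^k) p j * p ^ j
            / (q_poch p p j * q_poch (A*p/B) p j * q_poch (A*p/C) p j))"
      unfolding sum_distrib_left by (intro sum.cong refl) (simp add: v_def c_def mult_ac)
    also have "(\<Sum>j\<le>k. q_poch s p j * q_poch (A*p^k) p j * q_poch (1/p^k) p j * p ^ j
            / (q_poch p p j * q_poch (A*p/B) p j * q_poch (A*p/C) p j))
        = q_poch B p k * q_poch C p k * s ^ k / (q_poch (A*p/B) p k * q_poch (A*p/C) p k)"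
      unfolding s_def by (rule q_saalschuetz) (use nz d that q_poch_nonzero_le in auto)
    finally show ?thesis .
  qed
  \<comment> \<open>The power of s is produced by the Saalschuetz sum, and z is the argument of the
    remaining series without B and C.\<close>
  have sz: "A^2 * p^2 / (B*C*D*E*F) = s * z"
    by (simp add: s_def z_def power2_eq_square mult_ac)
  have "?L = (\<Sum>k\<le>N. (1 - A*p^(2*k)) * (v 0 k * (q_poch B p k * q_poch C p k * s ^ k
      / (q_poch (A*p/B) p k * q_poch (A*p/C) p k))))"
    unfolding sz by (intro sum.cong refl) (simp add: v_def d_def power_mult_distrib mult_ac)
  also have "\<dots> = (\<Sum>k\<le>N. \<Sum>j\<le>N. c j * ((1 - A*p^(2*k)) * v j k))"
  proof (intro sum.cong refl)
    fix k assume "k \<in> {..N}"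
    hence "v 0 k * (q_poch B p k * q_poch C p k * s ^ k / (q_poch (A*p/B) p k * q_poch (A*p/C) p k))
      = (\<Sum>j\<le>N. c j * v j k)" using inner by simp
    thus "(1 - A*p^(2*k)) * (v 0 k * (q_poch B p k * q_poch C p k * s ^ k
      / (q_poch (A*p/B) p k * q_poch (A*p/C) p k))) = (\<Sum>j\<le>N. c j * ((1 - A*p^(2*k)) * v j k))"
      by (simp only: sum_distrib_left mult.left_commute)
  qed
  also have "\<dots> = (\<Sum>j\<le>N. c j * (\<Sum>k\<le>N. (1 - A*p^(2*k)) * v j k))"
    unfolding sum_distrib_left by (rule sum.swap)
  also have "\<dots> = (\<Sum>j\<le>N. ?S * (c j * (q_poch D p j * q_poch E p j * q_poch F p j / q_poch (D*E*F/A) p j)))"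
    by (intro sum.cong refl) (simp add: rec)
  also have "\<dots> = ?S * ?R"
    unfolding sum_distrib_left[symmetric] by (intro arg_cong[of _ _ "(*) ?S"] sum.cong refl) (simp add: c_def s_def mult_ac)
  finally show ?thesis .
qed

text \<open>
  The recurrence in \<open>j\<close> links the sum to the one for \<open>j = N\<close>, which has a single nonzero term.
\<close>

lemma very_well_poised_6phi5_sum:
  fixes A D E F p :: "'a::field"
  assumes nz: "A \<noteq> 0" "D \<noteq> 0" "E \<noteq> 0" "p \<noteq> 0" and F: "F * p ^ N = 1"
    and d: "q_poch p p N \<noteq> 0" "q_poch (A*p/D) p N \<noteq> 0" "q_poch (A*p/E) p N \<noteq> 0" "q_poch (A*p/F) p N \<noteq> 0"
    and DEF: "q_poch D p N \<noteq> 0" "q_poch E p N \<noteq> 0"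
  shows "(\<Sum>k\<le>N. (1 - A*p^(2*k)) * (q_poch A p k * q_poch D p k * q_poch E p k * q_poch F p k)
        / (q_poch p p k * q_poch (A*p/D) p k * q_poch (A*p/E) p k * q_poch (A*p/F) p k)
        * (A*p / (D*E*F)) ^ k)
    = q_poch (D*E*F/A) p N * (1 - A*p^(2*N)) * q_poch A p N * (A*p / (D*E*F)) ^ N
      * q_poch (A*p^N) p N * q_poch F p N
      / (q_poch p p N * q_poch (A*p/D) p N * q_poch (A*p/E) p N * q_poch (A*p/F) p N)" (is "?S = _")
proof -
  define z where "z = A * p / (D * E * F)"
  define d where "d = (\<lambda>k. q_poch p p k * q_poch (A*p/D) p k * q_poch (A*p/E) p k * q_poch (A*p/F) p k)"
  define v where "v = (\<lambda>j k. q_poch A p k * q_poch D p k * q_poch E p k * q_poch F p k * z ^ k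
      * (q_poch (A*p^k) p j * q_poch (1/p^k) p j) / d k)"
  have dN: "d N \<noteq> 0" using d by (simp add: d_def)
  have S: "(\<Sum>k\<le>N. (1 - A*p^(2*k)) * v 0 k) = ?S"
    by (intro sum.cong refl) (simp add: v_def d_def z_def)
  have F': "F = 1 / p ^ N" using F nz by (simp add: field_simps)
  have FN: "q_poch F p N \<noteq> 0"
  proof (rule q_poch_nonzero)
    fix j assume j: "j < N"
    show "F * p ^ j \<noteq> 1"
    proof
      assume "F * p ^ j = 1"
      hence "p ^ j = p ^ N" using F by (metis mult_left_cancel mult_zero_left zero_neq_one)
      also have "p ^ N = p ^ j * p ^ (N - j)" using j by (simp flip: power_add)
      finally have "p * p ^ (N - j - 1) = 1" using nz j by (simp add: Suc_diff_Suc flip: power_Suc)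
      hence "q_poch p p N = 0" by (rule q_poch_eq_0) (use j in auto)
      thus False using d by simp
    qed
  qed
  have "q_poch (D*E*F/A) p N * (\<Sum>k\<le>N. (1 - A*p^(2*k)) * v N k)
      = q_poch D p N * q_poch E p N * q_poch F p N * (\<Sum>k\<le>N. (1 - A*p^(2*k)) * v 0 k)"
    unfolding v_def d_def z_def by (rule very_well_poised_sum_recurrence) (use nz F dN in \<open>auto simp: d_def\<close>)
  also have "(\<Sum>k\<le>N. (1 - A*p^(2*k)) * v N k) = (\<Sum>k\<in>{N}. (1 - A*p^(2*k)) * v N k)"
  proof (rule sum.mono_neutral_right)
    show "\<forall>k\<in>{..N} - {N}. (1 - A*p^(2*k)) * v N k = 0"
    proof
      fix k assume "k \<in> {..N} - {N}"
      hence "q_poch (1/p^k) p N = 0"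
        using nz by (intro q_poch_eq_0[of _ _ k]) auto
      thus "(1 - A*p^(2*k)) * v N k = 0" by (simp add: v_def)
    qed
  qed auto
  finally have "?S = q_poch (D*E*F/A) p N * ((1 - A*p^(2*N)) * v N N)
      / (q_poch D p N * q_poch E p N * q_poch F p N)"
    using FN DEF unfolding S by (simp add: field_simps)
  also have "\<dots> = q_poch (D*E*F/A) p N * (1 - A*p^(2*N)) * q_poch A p N * z ^ N
      * q_poch (A*p^N) p N * q_poch F p N / d N"
    using FN DEF dN by (simp add: v_def flip: F')
  finally show ?thesis by (simp add: z_def d_def)
qed

subsection \<open>The two sides of the congruence\<close>

text \<open>Polymorphic, so that one expression serves both over the fraction field of the
  polynomial ring and at complex points.\<close>

definition lhs_sum :: "nat \<Rightarrow> 'a::field \<Rightarrow> 'a \<Rightarrow> 'a \<Rightarrow> 'a" where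
  "lhs_sum n q a b = (\<Sum>k = 0..(n - 1) div 2.
     q_integer q (4 * k + 1)
     * ((q_poch_list [a * q, q / a, b * q] (q ^ 2) k * q_poch q (q ^ 2) k ^ 3)
        / (q_poch_list [a * q ^ 2, q ^ 2 / a, q ^ 2 / b] (q ^ 2) k * q_poch (q ^ 2) (q ^ 2) k ^ 3))
     * (q / b) ^ k)"

definition rhs_sum :: "nat \<Rightarrow> 'a::field \<Rightarrow> 'a \<Rightarrow> 'a \<Rightarrow> 'a" where
  "rhs_sum n q a b = q_integer q n * q powi ((1 - int n) div 2)
     * (\<Sum>k = 0..(n - 1) div 2.
          q_poch_list [a * q, q / a, q / b, q] (q ^ 2) k
          / (q_poch (q ^ 2 / b) (q ^ 2) k * q_poch (q ^ 2) (q ^ 2) k ^ 3)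
          * q ^ (2 * k))"

lemma q_integer_mult: "(1 - q) * q_integer q m = 1 - q ^ m"
  by (simp add: q_integer_def one_diff_power_eq)

lemma lhs_sum_inverse: "lhs_sum n q (1 / a) b = lhs_sum n q a b"
  by (simp add: lhs_sum_def q_poch_list_def mult_ac)

lemma rhs_sum_inverse: "rhs_sum n q (1 / a) b = rhs_sum n q a b"
  by (simp add: rhs_sum_def q_poch_list_def mult_ac)

lemma powi_half: 
  fixes q :: "'a::field"
  shows "q powi ((1 - int (2 * N + 1)) div 2) = 1 / q ^ N"
proof -
  have "(1 - int (2 * N + 1)) div 2 = - int N" by simp
  thus ?thesis by (simp add: power_int_minus inverse_eq_divide)
qed

text \<open>With a = q^-n every denominator factor not involving b is 1 minus a power of q. The only
  exponents that could be 0 are 2 + 2j - n, and they are odd.\<close>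

lemma denominators_nonzero:
  fixes q a b :: "'a::field"
  defines "p \<equiv> q ^ 2"
  assumes n: "odd n" and q: "q \<noteq> 0" "\<And>k. k > 0 \<Longrightarrow> q ^ k \<noteq> 1"
    and a: "a * q ^ n = 1" and b: "b \<noteq> 0" "\<And>k. b \<noteq> q ^ k"
  shows "q_poch (q ^ 2) p k \<noteq> 0" "q_poch (q ^ 2 / a) p k \<noteq> 0"
    "q_poch (a * q ^ 2) p k \<noteq> 0" "q_poch (q ^ 2 / b) p k \<noteq> 0"
proof -
  have pk: "p ^ k = q ^ (2 * k)" for k by (simp add: p_def power_mult)
  have inj: "i = j" if "q ^ i = q ^ j" for i j
    using that
  proof (induction i j rule: linorder_wlog)
    case (le i j)
    have "q ^ j = q ^ i * q ^ (j - i)" using le(1) by (simp flip: power_add)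
    hence "q ^ (j - i) = 1" using q le by simp
    thus ?case using q(2)[of "j - i"] le by (cases "j - i > 0") auto
  qed simp
  have a': "a = 1 / q ^ n" using a q by (simp add: field_simps)
  show "q_poch (q ^ 2) p k \<noteq> 0"
    by (rule q_poch_nonzero) (use q(2)[of "2 + 2 * j" for j] in \<open>simp add: pk power_add power2_eq_square mult_ac\<close>)
  show "q_poch (q ^ 2 / a) p k \<noteq> 0"
    by (rule q_poch_nonzero)
       (use q(2)[of "2 + n + 2 * j" for j] in \<open>simp add: pk power_add a' power2_eq_square mult_ac\<close>)
  show "q_poch (a * q ^ 2) p k \<noteq> 0"
  proof (rule q_poch_nonzero)
    fix j
    show "a * q ^ 2 * p ^ j \<noteq> 1"
    proof
      assume "a * q ^ 2 * p ^ j = 1"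
      hence "q ^ (2 + 2 * j) = q ^ n" using q by (simp add: a' pk power_add field_simps power2_eq_square)
      hence "2 + 2 * j = n" by (rule inj)
      thus False using n by auto
    qed
  qed
  show "q_poch (q ^ 2 / b) p k \<noteq> 0"
  proof (rule q_poch_nonzero)
    fix j
    show "q ^ 2 / b * p ^ j \<noteq> 1" 
      using b(1) b(2)[of "2 + 2 * j"] by (auto simp: pk power_add field_simps power2_eq_square)
  qed
qed

text \<open>Watson's transformation is applied in base p = q^2 with A = C = E = q, B = bq, D = q/a
  and F = aq. Then Ap/(BC) = q/b, DEF/A = q^2, the argument is q/b, and the very-well-poised factor
  1 - q p^(2k) is (1 - q)[4k + 1].\<close>

lemma lhs_sum_eq_rhs_sum:
  fixes q a b :: "'a::field"
  assumes n: "odd n" and q: "q \<noteq> 0" "\<And>k. k > 0 \<Longrightarrow> q ^ k \<noteq> 1"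
    and a: "a * q ^ n = 1" and b: "b \<noteq> 0" "\<And>k. b \<noteq> q ^ k"
  shows "lhs_sum n q a b = rhs_sum n q a b"
proof -
  from n obtain N where N: "n = 2 * N + 1" by (elim oddE)
  hence N': "(n - 1) div 2 = N" by simp
  define p where "p = q ^ 2"
  have a0: "a \<noteq> 0" using a by auto
  have p: "p \<noteq> 0" and pk: "p ^ k = q ^ (2 * k)" for k
    using q by (simp_all add: p_def power_mult)
  note d = denominators_nonzero[OF n q a b, folded p_def]
  have dq: "q_poch q p k \<noteq> 0" for k
    by (rule q_poch_nonzero) (use q(2)[of "1 + 2 * j" for j] in \<open>simp add: pk power_add power2_eq_square mult_ac\<close>)
  have a': "a = 1 / q ^ n" using a q by (simp add: field_simps)
  have dD: "q_poch (q / a) p k \<noteq> 0" for k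
    by (rule q_poch_nonzero)
       (use q(2)[of "1 + n + 2 * j" for j] in \<open>simp add: pk power_add a' power2_eq_square mult_ac\<close>)
  have AB: "q * p / (b * q) = q ^ 2 / b" "q * p / q = q ^ 2" "q * p / (q / a) = a * q ^ 2"
      "q * p / (a * q) = q ^ 2 / a" "q / a * q * (a * q) / q = q ^ 2"
      "q * p / (q / a * q * (a * q)) = 1" "q * p / (b * q * q) = q / b"
      "p * p ^ 2 / (b * q * q * (q / a) * q * (a * q)) = q / b"
    using q a0 b by (simp_all add: p_def field_simps power2_eq_square)
  have F: "a * q * p ^ N = 1" using a by (simp add: pk N mult_ac)
  have nz: "b * q \<noteq> 0" "q / a \<noteq> 0" using b q a0 by auto
  have ql: "1 - q * p ^ (2 * k) = (1 - q) * q_integer q (4 * k + 1)" for k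
    unfolding q_integer_mult pk by simp
  define S where "S = (\<Sum>k\<le>N. (1 - q*p^(2*k)) * (q_poch q p k * q_poch (q/a) p k * q_poch q p k * q_poch (a*q) p k)
        / (q_poch p p k * q_poch (q*p/(q/a)) p k * q_poch (q*p/q) p k * q_poch (q*p/(a*q)) p k)
        * (q*p / (q/a*q*(a*q))) ^ k)"
  have "(1 - q) * lhs_sum n q a b = S * (\<Sum>j\<le>N. q_poch (q*p/(b*q*q)) p j * q_poch (q/a) p j * q_poch q p j * q_poch (a*q) p j
        / (q_poch p p j * q_poch (q*p/(b*q)) p j * q_poch (q*p/q) p j * q_poch (q/a*q*(a*q)/q) p j) * p ^ j)"
    unfolding S_def
  proof (subst watson_8phi7[where A = q and B = "b*q" and C = q and D = "q/a" and E = q and F = "a*q"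
        and p = p and N = N, symmetric])
    show "(1 - q) * lhs_sum n q a b = (\<Sum>k\<le>N. (1 - q * p ^ (2 * k)) *
          (q_poch q p k * q_poch (b * q) p k * q_poch q p k * q_poch (q / a) p k *
            q_poch q p k * q_poch (a * q) p k) /
          (q_poch p p k * q_poch (q * p / (b * q)) p k * q_poch (q * p / q) p k *
            q_poch (q * p / (q / a)) p k * q_poch (q * p / q) p k * q_poch (q * p / (a * q)) p k) *
          (q\<^sup>2 * p\<^sup>2 / (b * q * q * (q / a) * q * (a * q))) ^ k)"
      unfolding AB ql lhs_sum_def N' sum_distrib_left atLeast0AtMost p_def[symmetric]
      by (intro sum.cong refl) (simp add: q_poch_list_def power3_eq_cube mult_ac)
  qed (use nz q p F d in \<open>simp_all only: AB p_def[symmetric]\<close>, (simp_all add: p_def)?)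
  also have "S = (1 - q ^ n) / q ^ N"
  proof -
    have cancel: "u * g * w * h * (u * s * R) / (u * (w * t * R) * u * v) = h * g / v * (s / t)"
      if "u \<noteq> 0" "w \<noteq> 0" "R \<noteq> 0" "t \<noteq> 0" "v \<noteq> 0" for u g w h s R t v :: 'a
      using that by (simp add: divide_simps)
    have "S = q_poch p p N * (1 - q*p^(2*N)) * q_poch q p N * q_poch (q*p^N) p N * q_poch (a*q) p N
      / (q_poch p p N * q_poch (a*q^2) p N * q_poch p p N * q_poch (q^2/a) p N)"
      unfolding S_def
      by (subst very_well_poised_6phi5_sum) (use nz q p F d dq dD in \<open>simp_all only: AB p_def[symmetric]\<close>, simp_all add: p_def)
    \<comment> \<open>Reflecting the symbols at aq and aq^2 turns them into those at p and q, which
      cancel. The leftover quotient of monomials is q^-N, the source of q^((1-n)/2).\<close>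
    also have "q_poch (a*q) p N = q_poch p p N * (- (a*q)) ^ N * (\<Prod>i<N. p ^ i)"
      by (rule q_poch_reflect) (use F p in \<open>simp_all add: mult_ac\<close>)
    also have "q_poch (a*q^2) p N = q_poch q p N * (- (a*q^2)) ^ N * (\<Prod>i<N. p ^ i)"
      by (rule q_poch_reflect) (use F p in \<open>simp_all add: mult_ac p_def power2_eq_square\<close>)
    also have "q_poch p p N * (1 - q*p^(2*N)) * q_poch q p N * q_poch (q*p^N) p N * (q_poch p p N * (- (a*q)) ^ N * (\<Prod>i<N. p ^ i))
      / (q_poch p p N * (q_poch q p N * (- (a*q^2)) ^ N * (\<Prod>i<N. p ^ i)) * q_poch p p N * q_poch (q^2/a) p N)
      = (q_poch (q*p^N) p N * (1 - q*p^(2*N))) / q_poch (q^2/a) p N * ((- (a*q)) ^ N / (- (a*q^2)) ^ N)"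
      by (rule cancel) (use d(1,2)[of N] dq[of N] p q a0 in \<open>simp_all add: p_def[symmetric]\<close>)
    also have "(- (a*q)) ^ N / (- (a*q^2)) ^ N = 1 / q ^ N"
      using q a0 by (simp add: power_mult_distrib power2_eq_square divide_simps flip: power_divide)
    \<comment> \<open>The very-well-poised factor is the missing last factor of the symbol at q p^N
      = q^n. Splitting off the first one instead yields 1 - q^n, hence [n], times the symbol at
      q^(n+2) = q^2/a.\<close>
    also have "q_poch (q*p^N) p N * (1 - q*p^(2*N)) = q_poch (q*p^N) p (Suc N)"
      by (simp add: q_poch_Suc mult_2 mult_2_right power_add mult_ac)
    also have "\<dots> = (1 - q ^ n) * q_poch (q^2/a) p N"
    proof -
      have "q * p ^ N = q ^ n" by (simp add: pk N)
      moreover from this have "q * p ^ N * p = q ^ 2 / a" using q by (simp add: a' p_def)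
      ultimately show ?thesis by (simp only: q_poch_Suc_left)
    qed
    finally show ?thesis using d(2)[of N] by (simp add: p_def)
  qed
  finally have "(1 - q) * lhs_sum n q a b = (1 - q) * q_integer q n * (1 / q ^ N) * 
      (\<Sum>j\<le>N. q_poch_list [a * q, q / a, q / b, q] p j
          / (q_poch (q ^ 2 / b) p j * q_poch p p j ^ 3) * p ^ j)"
    unfolding AB q_integer_mult
    by (simp add: q_poch_list_def power3_eq_cube mult_ac flip: p_def)
  also have "\<dots> = (1 - q) * rhs_sum n q a b"
    unfolding rhs_sum_def N' atLeast0AtMost N powi_half pk by (simp add: p_def mult_ac)
  finally show ?thesis using q(2)[of 1] by simp
qed

section \<open>Vanishing at primitive roots of unity\<close>

text \<open>Because q p^N = 1, the last k factors of (xq; p) up to N are, up to a monomial, the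
  first k factors of (q^2/x; p), and conversely. Reversal thus swaps numerator and denominator
  tails, so \<open>r (N - k)\<close> is a monomial multiple of \<open>r k\<close>; the second claim
  is the case k = N.\<close>

lemma q_poch_quotient_reflect:
  fixes x q :: "'a::field" and N :: nat
  defines "p \<equiv> q ^ 2"
  defines "r \<equiv> \<lambda>k. q_poch (x * q) p k / q_poch (q ^ 2 / x) p k"
  assumes q: "q ^ (2 * N + 1) = 1" and x: "x \<noteq> 0" and d: "q_poch (q ^ 2 / x) p N \<noteq> 0"
  shows "k \<le> N \<Longrightarrow> r (N - k) = r N * (q / x ^ 2) ^ k * r k"
    and "r N * (- (q ^ 2 / x)) ^ N * (\<Prod>i<N. p ^ i) = 1"
proof -
  define R where "R = (\<lambda>k. \<Prod>i<k. p ^ i)"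
  have q0: "q \<noteq> 0" using q by (auto simp: power_0_left split: if_splits)
  hence p0: "p \<noteq> 0" by (simp add: p_def)
  have qN: "q * p ^ N = 1" using q by (simp add: p_def power_mult)
  have R0: "R k \<noteq> 0" for k using p0 by (simp add: R_def)
  have pN: "p ^ (N - k) * p ^ k = p ^ N" if "k \<le> N" for k
    using that by (simp flip: power_add)
  have refl: "q_poch y p N * (- z) ^ k * R k = q_poch y p (N - k) * q_poch z p k"
    if "k \<le> N" "y * z = q ^ 2 * q" for k y z
  proof -
    have "q_poch z p k = q_poch (y * p ^ (N - k)) p k * (- z) ^ k * R k"
      unfolding R_def
    proof (rule q_poch_reflect)
      have "y * p ^ (N - k) * z * p ^ k = (y * z) * (p ^ (N - k) * p ^ k)" by (simp add: mult_ac)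
      also have "\<dots> = q ^ 2 * (q * p ^ N)" unfolding that(2) pN[OF that(1)] by (simp add: mult_ac)
      finally show "y * p ^ (N - k) * z * p ^ k = p" unfolding qN by (simp add: p_def)
    qed (fact p0)
    moreover have "q_poch y p N = q_poch y p (N - k) * q_poch (y * p ^ (N - k)) p k"
      using q_poch_add[of y p "N - k" k] that by simp
    ultimately show ?thesis by simp
  qed
  have yz: "x * q * (q ^ 2 / x) = q ^ 2 * q" "q ^ 2 / x * (x * q) = q ^ 2 * q"
    using x by simp_all
  show "r (N - k) = r N * (q / x ^ 2) ^ k * r k" if k: "k \<le> N"
  proof -
    have 1: "q_poch (x*q) p (N - k) = q_poch (x*q) p N * (- (q^2/x)) ^ k * R k / q_poch (q^2/x) p k"
      using refl[OF k yz(1)] q_poch_nonzero_le[OF d k] by (simp add: field_simps)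
    have 2: "q_poch (q^2/x) p N * (- (x*q)) ^ k * R k = q_poch (q^2/x) p (N - k) * q_poch (x*q) p k"
      by (rule refl[OF k yz(2)])
    moreover have "q_poch (q^2/x) p N * (- (x*q)) ^ k * R k \<noteq> 0"
      using d x q0 R0 by simp
    ultimately have nz: "q_poch (x*q) p k \<noteq> 0" by auto
    have 3: "q_poch (q^2/x) p (N - k) = q_poch (q^2/x) p N * (- (x*q)) ^ k * R k / q_poch (x*q) p k"
      using 2 nz by (simp add: field_simps)
    have "r (N - k) = q_poch (x*q) p N / q_poch (q^2/x) p N * ((- (q^2/x)) ^ k / (- (x*q)) ^ k)
        * (q_poch (x*q) p k / q_poch (q^2/x) p k)"
      unfolding r_def 1 3 using R0[of k] by (simp add: field_simps)
    also have "(- (q^2/x)) ^ k / (- (x*q)) ^ k = (q / x ^ 2) ^ k"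
      using q0 x unfolding power_divide[symmetric]
      by (intro arg_cong[of _ _ "\<lambda>u. u ^ k"]) (simp add: field_simps power2_eq_square)
    finally show ?thesis by (simp add: r_def)
  qed
  show "r N * (- (q ^ 2 / x)) ^ N * (\<Prod>i<N. p ^ i) = 1"
    using refl[OF order_refl yz(1)] d by (simp add: r_def R_def field_simps)
qed

text \<open>The product is p^(N(N-1)/2); squaring it and multiplying by p^N avoids the halved
  exponent.\<close>

lemma prod_power_index: "(\<Prod>i<N. p ^ i) ^ 2 * p ^ N = (p :: 'a::comm_monoid_mult) ^ N\<^sup>2"
proof (induction N)
  case (Suc N)
  have "(\<Prod>i<Suc N. p ^ i) ^ 2 * p ^ Suc N = ((\<Prod>i<N. p ^ i) ^ 2 * p ^ N) * p ^ (2 * N + 1)"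
    by (simp add: power_mult_distrib power_add power_mult power2_eq_square mult_ac)
  also have "\<dots> = p ^ (N\<^sup>2 + (2 * N + 1))"
    unfolding Suc.IH by (simp only: power_add)
  also have "N\<^sup>2 + (2 * N + 1) = (Suc N)\<^sup>2" by (simp add: power2_eq_square)
  finally show ?case .
qed simp

text \<open>The four values of x give the arguments q^2/a, a q^2, q^2/b and q^2. For x = 1 the
  exponents 2 + 2j stay below n because the sums stop at (n - 1)/2.\<close>

lemma denominators_nonzero_root_of_unity:
  fixes q a b x :: "'a::field"
  assumes q: "\<And>m. 0 < m \<Longrightarrow> m < n \<Longrightarrow> q ^ m \<noteq> 1"
    and a: "a \<noteq> 0" "\<And>k. a * q ^ k \<noteq> 1" "\<And>k. a \<noteq> q ^ k" and b: "b \<noteq> 0" "\<And>k. b \<noteq> q ^ k"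
    and x: "x \<in> {a, 1 / a, b, 1}" and N: "N \<le> (n - 1) div 2"
  shows "q_poch (q ^ 2 / x) (q ^ 2) N \<noteq> 0"
proof -
  have pk: "(q ^ 2) ^ k = q ^ (2 * k)" for k by (simp add: power_mult)
  have x0: "x \<noteq> 0" using a b x by auto
  show "q_poch (q ^ 2 / x) (q ^ 2) N \<noteq> 0"
  proof (rule q_poch_nonzero)
    fix j assume j: "j < N"
    have "q ^ (2 + 2 * j) \<noteq> x"
    proof
      assume "q ^ (2 + 2 * j) = x"
      with x consider "a = q ^ (2 + 2 * j)" | "q ^ (2 + 2 * j) = 1 / a" | "b = q ^ (2 + 2 * j)"
        | "q ^ (2 + 2 * j) = 1" by blast
      thus False
      proof cases
        case 2
        hence "a * q ^ (2 + 2 * j) = 1" using a(1) by simp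
        thus False using a(2) by blast
      next
        case 4
        hence "\<not> 2 + 2 * j < n" using q[of "2 + 2 * j"] by auto
          thus False using j N by linarith
      qed (use a(3) b(2) in blast)+
    qed
    thus "q ^ 2 / x * (q ^ 2) ^ j \<noteq> 1" using x0 unfolding pk by (simp add: power_add power2_eq_square mult_ac)
  qed
qed

lemma lhs_sum_root_of_unity:
  fixes q a b :: "'a::field_char_0"
  assumes n: "odd n" "n > 1" and q: "q ^ n = 1" "\<And>m. 0 < m \<Longrightarrow> m < n \<Longrightarrow> q ^ m \<noteq> 1"
    and a: "a \<noteq> 0" "\<And>k. a * q ^ k \<noteq> 1" "\<And>k. a \<noteq> q ^ k" and b: "b \<noteq> 0" "\<And>k. b \<noteq> q ^ k"
  shows "lhs_sum n q a b = 0"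
proof -
  from n obtain N where N: "n = 2 * N + 1" by (elim oddE)
  hence N': "(n - 1) div 2 = N" by simp
  define p where "p = q ^ 2"
  define r where "r = (\<lambda>x k. q_poch (x * q) p k / q_poch (q ^ 2 / x) p k)"
  define P where "P = (\<lambda>k. r a k * r (1/a) k * r b k * r 1 k ^ 3)"
  define c where "c = (\<lambda>k. q_integer q (4 * k + 1) * P k * (q / b) ^ k)"
  define R where "R = (\<Prod>i<N. p ^ i)"
  have q0: "q \<noteq> 0" using q n by (auto simp: power_0_left split: if_splits)
  have q1: "q \<noteq> 1" using q(2)[of 1] n by auto
  have pk: "p ^ k = q ^ (2 * k)" for k by (simp add: p_def power_mult)
  have nz: "x \<noteq> 0 \<and> q_poch (q ^ 2 / x) p N \<noteq> 0" if "x \<in> {a, 1/a, b, 1}" for x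
  proof
    show "x \<noteq> 0" using that a b by auto
    show "q_poch (q ^ 2 / x) p N \<noteq> 0"
      unfolding p_def by (rule denominators_nonzero_root_of_unity[OF q(2) a b that]) (use N' in auto)
  qed
  have qN: "q ^ (2 * N + 1) = 1" using q N by simp
  have r1: "r x (N - k) = r x N * (q / x ^ 2) ^ k * r x k" if "x \<in> {a, 1/a, b, 1}" "k \<le> N" for x k
    unfolding r_def p_def 
    by (rule q_poch_quotient_reflect(1)) (use nz[OF that(1)] qN that(2) in \<open>auto simp: p_def\<close>)
  have r2: "r x N * (- (q ^ 2 / x)) ^ N * R = 1" if "x \<in> {a, 1/a, b, 1}" for x
    unfolding r_def p_def R_def
    by (rule q_poch_quotient_reflect(2)) (use nz[OF that(1)] qN in \<open>auto simp: p_def\<close>)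
  have PNk: "P (N - k) = P N * (q ^ 6 / b ^ 2) ^ k * P k" if "k \<le> N" for k
  proof -
    have "P (N - k) = P N * P k * ((q / a ^ 2) ^ k * (q / (1/a) ^ 2) ^ k * (q / b ^ 2) ^ k * ((q / 1 ^ 2) ^ k) ^ 3)"
      unfolding P_def using that by (simp add: r1 power_mult_distrib mult_ac)
    also have "((q / a ^ 2) ^ k * (q / (1/a) ^ 2) ^ k * (q / b ^ 2) ^ k * ((q / 1 ^ 2) ^ k) ^ 3)
      = ((q / a ^ 2) * (q / (1/a) ^ 2) * (q / b ^ 2) * (q / 1 ^ 2) ^ 3) ^ k"
      by (simp only: power_mult_distrib power_mult[symmetric] mult.commute[of k])
    also have "(q / a ^ 2) * (q / (1/a) ^ 2) * (q / b ^ 2) * (q / 1 ^ 2) ^ 3 = q ^ 6 / b ^ 2"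
      using a b by (simp add: field_simps eval_nat_numeral)
    finally show ?thesis by (simp add: mult_ac)
  qed
  have PN: "P N * (q / b) ^ N = q"
  proof -
    have "1 = (r a N * (- (q^2/a)) ^ N * R) * (r (1/a) N * (- (q^2/(1/a))) ^ N * R) *
        (r b N * (- (q^2/b)) ^ N * R) * (r 1 N * (- (q^2/1)) ^ N * R) ^ 3"
      by (simp only: r2 insert_iff simp_thms mult_1_left power_one)
    also have "\<dots> = P N * R ^ 6 * ((- (q^2/a)) * (- (q^2/(1/a))) * (- (q^2/b)) * (- (q^2/1)) ^ 3) ^ N"
      unfolding P_def by (simp only: power_mult_distrib power_mult[symmetric] mult.commute[of N 3])
        (simp add: eval_nat_numeral mult_ac)
    also have "(- (q^2/a)) * (- (q^2/(1/a))) * (- (q^2/b)) * (- (q^2/1)) ^ 3 = q ^ 12 / b"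
      using a b by (simp add: field_simps eval_nat_numeral)
    finally have "P N * R ^ 6 * q ^ (12 * N) = b ^ N"
      using b by (simp add: power_divide field_simps flip: power_mult)
    also have "P N * R ^ 6 * q ^ (12 * N) = P N * (R ^ 2 * p ^ N) ^ 3 * q ^ (6 * N)"
      unfolding pk by (simp add: power_mult_distrib flip: power_mult power_add)
    also have "R ^ 2 * p ^ N = q ^ (2 * N\<^sup>2)"
      unfolding R_def prod_power_index by (rule pk)
    finally have "P N * q ^ (6 * N\<^sup>2 + 6 * N) = b ^ N"
      by (simp add: power_add mult.assoc flip: power_mult)
    \<comment> \<open>The extra q brings the exponent to N modulo n: 6N^2 + 6N + 1 = N + (2N + 1)(3N
      + 1).\<close>
    hence "P N * (q ^ (6 * N\<^sup>2 + 6 * N) * q) = b ^ N * q" by (simp add: mult_ac)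
    also have "q ^ (6 * N\<^sup>2 + 6 * N) * q = q ^ (N + (2 * N + 1) * (3 * N + 1))"
      unfolding power_Suc2[symmetric] by (intro arg_cong[of _ _ "\<lambda>m. q ^ m"]) (simp add: power2_eq_square algebra_simps)
    also have "\<dots> = q ^ N"
      unfolding power_add[of q N] power_mult[of q "2 * N + 1"] qN by simp
    finally show ?thesis using b by (simp add: power_divide field_simps)
  qed
  \<comment> \<open>The exponents 4k + 1 and 4(N - k) + 1 add up to 2n, so the two powers of q are
    reciprocal, and u(1 - 1/u) = -(1 - u).\<close>
  have int_reflect: "q ^ (4 * k + 1) * q_integer q (4 * (N - k) + 1) = - q_integer q (4 * k + 1)" if "k \<le> N" for k
  proof -
    have "q ^ (4 * k + 1) * q ^ (4 * (N - k) + 1) = q ^ (n * 2)"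
      using that by (simp only: power_add[symmetric] N) (intro arg_cong[of _ _ "\<lambda>m. q ^ m"], simp)
    also have "\<dots> = 1" unfolding power_mult q by simp
    finally have "(1 - q) * (q ^ (4 * k + 1) * q_integer q (4 * (N - k) + 1)) = (1 - q) * (- q_integer q (4 * k + 1))"
      unfolding mult.left_commute[of "1 - q"] mult_minus_right q_integer_mult by (simp add: right_diff_distrib)
    thus ?thesis by (subst (asm) mult_left_cancel) (use q1 in auto)
  qed
  have anti: "c (N - k) = - c k" if "k \<le> N" for k
  proof -
    have qb: "(q / b) ^ (N - k) * (q / b) ^ k = (q / b) ^ N" 
      using that by (simp flip: power_add)
    have "q ^ (4 * k + 1) * c (N - k) * (q / b) ^ k
      = (q ^ (4 * k + 1) * q_integer q (4 * (N - k) + 1)) * P k * (P N * ((q / b) ^ (N - k) * (q / b) ^ k)) * (q ^ 6 / b ^ 2) ^ k"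
      unfolding c_def PNk[OF that] by (simp only: mult_ac)
    also have "\<dots> = - q_integer q (4 * k + 1) * P k * (q * (q ^ 6 / b ^ 2) ^ k)"
      unfolding int_reflect[OF that] qb PN by (simp only: mult_ac)
    also have "q * (q ^ 6 / b ^ 2) ^ k = q ^ (4 * k + 1) * ((q / b) ^ k * (q / b) ^ k)"
    proof -
      have *: "q ^ 6 / b ^ 2 = q ^ 4 * (q / b) ^ 2"
        by (simp add: power_divide flip: power_add)
      show ?thesis unfolding * by (simp add: power_mult power_mult_distrib power_divide power2_eq_square)
    qed
    finally have "q ^ (4 * k + 1) * (q / b) ^ k * c (N - k) = q ^ (4 * k + 1) * (q / b) ^ k * (- c k)"
      unfolding c_def by (simp only: mult_ac minus_mult_left[symmetric] minus_mult_right[symmetric])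
    thus ?thesis by (subst (asm) mult_left_cancel) (use q0 b in auto)
  qed
  have "lhs_sum n q a b = (\<Sum>k = 0..N. c k)"
    unfolding lhs_sum_def N' c_def P_def r_def p_def
    by (intro sum.cong refl) (simp add: q_poch_list_def power_divide mult_ac)
  also have "\<dots> = (\<Sum>k = 0..N. c (N - k))"
    using sum.atLeastAtMost_rev[of c 0 N] by simp
  also have "\<dots> = - (\<Sum>k = 0..N. c k)"
    unfolding sum_negf[symmetric] by (intro sum.cong refl anti) auto
  \<comment> \<open>The sum equals its own negative, so characteristic 0 makes it vanish. This also
    covers the middle term for even N, which is its own partner.\<close>
  finally have "(\<Sum>k = 0..N. c k) = 0" and "lhs_sum n q a b = (\<Sum>k = 0..N. c k)"
    using \<open>lhs_sum n q a b = (\<Sum>k = 0..N. c k)\<close> by (simp_all add: eq_neg_iff_add_eq_0 flip: mult_2)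
  thus ?thesis by simp
qed

lemma rhs_sum_root_of_unity:
  fixes q a b :: "'a::field"
  assumes "q ^ n = 1" "q \<noteq> 1"
  shows "rhs_sum n q a b = 0"
  using q_integer_mult[of q n] assms by (simp add: rhs_sum_def)

subsection \<open>Evaluation at complex points\<close>

locale ring_hom_on =
  fixes \<phi> :: "'a::comm_ring_1 \<Rightarrow> 'b::comm_ring_1"
  assumes hom_1 [simp]: "\<phi> 1 = 1"
    and hom_add [simp]: "\<phi> (x + y) = \<phi> x + \<phi> y"
    and hom_mult [simp]: "\<phi> (x * y) = \<phi> x * \<phi> y"
begin

lemma hom_0 [simp]: "\<phi> 0 = 0"
  using hom_add[of 0 0] by simp

lemma hom_uminus [simp]: "\<phi> (- x) = - \<phi> x"
  using hom_add[of x "- x"] by (simp add: eq_neg_iff_add_eq_0 add.commute)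

lemma hom_diff [simp]: "\<phi> (x - y) = \<phi> x - \<phi> y"
  using hom_add[of x "- y"] by simp

lemma hom_power [simp]: "\<phi> (x ^ k) = \<phi> x ^ k"
  by (induction k) simp_all

lemma eval_pCons [simp]: "poly (map_poly \<phi> (pCons c p)) x = \<phi> c + x * poly (map_poly \<phi> p) x"
  by (simp add: map_poly_pCons)

lemma eval_add: "poly (map_poly \<phi> (p + r)) x = poly (map_poly \<phi> p) x + poly (map_poly \<phi> r) x"
  by (induction p r rule: poly_induct2) (simp_all add: algebra_simps)

lemma eval_smult: "poly (map_poly \<phi> (smult c p)) x = \<phi> c * poly (map_poly \<phi> p) x"
  by (induction p) (simp_all add: algebra_simps)

lemma eval_mult: "poly (map_poly \<phi> (p * r)) x = poly (map_poly \<phi> p) x * poly (map_poly \<phi> r) x"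
  by (induction p) (simp_all add: eval_add eval_smult algebra_simps)

text \<open>Applied three times, starting from \<open>of_int\<close>, this yields evaluation in q,
  then a, then b.\<close>

lemma eval_hom: "ring_hom_on (\<lambda>p. poly (map_poly \<phi> p) x)"
  by unfold_locales (simp_all add: eval_add eval_mult)

lemma eval_poly: "\<phi> (poly p y) = poly (map_poly \<phi> p) (\<phi> y)"
  by (induction p) simp_all

end

definition has_value :: "('a::idom \<Rightarrow> 'b::field) \<Rightarrow> 'a fract \<Rightarrow> 'b \<Rightarrow> bool" where
  "has_value \<phi> r v \<longleftrightarrow> (\<exists>x y. r = to_fract x / to_fract y \<and> \<phi> y \<noteq> 0 \<and> v = \<phi> x / \<phi> y)"

locale evaluation = ring_hom_on \<phi> for \<phi> :: "'a::idom \<Rightarrow> 'b::field"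
begin

lemma nonzero_of_hom: "\<phi> y \<noteq> 0 \<Longrightarrow> y \<noteq> 0" by auto

lemma has_value_to_fract: "has_value \<phi> (to_fract x) (\<phi> x)"
  unfolding has_value_def by (rule exI[of _ x], rule exI[of _ 1]) simp

lemma has_value_0: "has_value \<phi> 0 0"
  using has_value_to_fract[of 0] by simp

lemma has_value_1: "has_value \<phi> 1 1"
  using has_value_to_fract[of 1] by simp

lemma has_value_add:
  assumes "has_value \<phi> r v" "has_value \<phi> s w"
  shows "has_value \<phi> (r + s) (v + w)"
proof -
  obtain x y where 1: "r = to_fract x / to_fract y" "\<phi> y \<noteq> 0" "v = \<phi> x / \<phi> y"
    using assms(1) by (auto simp: has_value_def)
  obtain x' y' where 2: "s = to_fract x' / to_fract y'" "\<phi> y' \<noteq> 0" "w = \<phi> x' / \<phi> y'"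
    using assms(2) by (auto simp: has_value_def)
  show ?thesis unfolding has_value_def
    by (rule exI[of _ "x * y' + x' * y"], rule exI[of _ "y * y'"])
       (use 1 2 nonzero_of_hom in \<open>auto simp: add_frac_eq\<close>)
qed

lemma has_value_uminus: "has_value \<phi> r v \<Longrightarrow> has_value \<phi> (- r) (- v)"
  unfolding has_value_def by (metis hom_uminus minus_divide_left to_fract_uminus)

lemma has_value_diff: "has_value \<phi> r v \<Longrightarrow> has_value \<phi> s w \<Longrightarrow> has_value \<phi> (r - s) (v - w)"
  using has_value_add[of r v "- s" "- w"] has_value_uminus[of s w] by simp

lemma has_value_mult:
  assumes "has_value \<phi> r v" "has_value \<phi> s w"
  shows "has_value \<phi> (r * s) (v * w)"
proof -
  obtain x y where 1: "r = to_fract x / to_fract y" "\<phi> y \<noteq> 0" "v = \<phi> x / \<phi> y"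
    using assms(1) by (auto simp: has_value_def)
  obtain x' y' where 2: "s = to_fract x' / to_fract y'" "\<phi> y' \<noteq> 0" "w = \<phi> x' / \<phi> y'"
    using assms(2) by (auto simp: has_value_def)
  show ?thesis unfolding has_value_def
    by (rule exI[of _ "x * x'"], rule exI[of _ "y * y'"]) (use 1 2 in auto)
qed

lemma has_value_inverse:
  assumes "has_value \<phi> r v" "v \<noteq> 0"
  shows "has_value \<phi> (inverse r) (inverse v)"
proof -
  obtain x y where 1: "r = to_fract x / to_fract y" "\<phi> y \<noteq> 0" "v = \<phi> x / \<phi> y"
    using assms(1) by (auto simp: has_value_def)
  show ?thesis unfolding has_value_def
    by (rule exI[of _ y], rule exI[of _ x]) (use 1 assms(2) in auto)
qed

lemma has_value_divide:
  "has_value \<phi> r v \<Longrightarrow> has_value \<phi> s w \<Longrightarrow> w \<noteq> 0 \<Longrightarrow> has_value \<phi> (r / s) (v / w)"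
  unfolding divide_inverse by (intro has_value_mult has_value_inverse)

lemma has_value_power: "has_value \<phi> r v \<Longrightarrow> has_value \<phi> (r ^ k) (v ^ k)"
  by (induction k) (simp_all add: has_value_1 has_value_mult)

lemma has_value_powi: "has_value \<phi> r v \<Longrightarrow> v \<noteq> 0 \<Longrightarrow> has_value \<phi> (r powi k) (v powi k)"
  by (auto simp: power_int_def intro: has_value_power has_value_inverse)

lemma has_value_sum:
  "(\<And>i. i \<in> A \<Longrightarrow> has_value \<phi> (f i) (g i)) \<Longrightarrow> has_value \<phi> (\<Sum>i\<in>A. f i) (\<Sum>i\<in>A. g i)"
  by (induction A rule: infinite_finite_induct) (simp_all add: has_value_0 has_value_add)

lemma has_value_prod:
  "(\<And>i. i \<in> A \<Longrightarrow> has_value \<phi> (f i) (g i)) \<Longrightarrow> has_value \<phi> (\<Prod>i\<in>A. f i) (\<Prod>i\<in>A. g i)"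
  by (induction A rule: infinite_finite_induct) (simp_all add: has_value_1 has_value_mult)

lemma has_value_q_poch:
  "has_value \<phi> r v \<Longrightarrow> has_value \<phi> s w \<Longrightarrow> has_value \<phi> (q_poch r s k) (q_poch v w k)"
  unfolding q_poch_def
  by (intro has_value_prod has_value_diff has_value_1 has_value_mult has_value_power)

lemma has_value_q_integer: "has_value \<phi> r v \<Longrightarrow> has_value \<phi> (q_integer r k) (q_integer v k)"
  unfolding q_integer_def by (intro has_value_sum has_value_power)

lemmas has_value_intros = has_value_divide has_value_mult has_value_power has_value_q_poch
  has_value_q_integer has_value_diff has_value_1 has_value_sum has_value_powi

lemma has_value_lhs_rhs:
  assumes "has_value \<phi> q Q" "has_value \<phi> a \<alpha>" "has_value \<phi> b \<beta>"
    and nz: "Q \<noteq> 0" "\<alpha> \<noteq> 0" "\<beta> \<noteq> 0"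
    and d: "\<And>k. k \<le> (n - 1) div 2 \<Longrightarrow> q_poch (Q ^ 2) (Q ^ 2) k \<noteq> 0"
       "\<And>k. k \<le> (n - 1) div 2 \<Longrightarrow> q_poch (\<alpha> * Q ^ 2) (Q ^ 2) k \<noteq> 0"
       "\<And>k. k \<le> (n - 1) div 2 \<Longrightarrow> q_poch (Q ^ 2 / \<alpha>) (Q ^ 2) k \<noteq> 0"
       "\<And>k. k \<le> (n - 1) div 2 \<Longrightarrow> q_poch (Q ^ 2 / \<beta>) (Q ^ 2) k \<noteq> 0"
  shows "has_value \<phi> (lhs_sum n q a b - rhs_sum n q a b) (lhs_sum n Q \<alpha> \<beta> - rhs_sum n Q \<alpha> \<beta>)"
  unfolding lhs_sum_def rhs_sum_def q_poch_list_def list.map prod_list.Cons prod_list.Nil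
  by (intro has_value_intros assms) (use nz d in auto)

end

text \<open>Cross-multiplying an admissible representation x/y with the reduced form u/v gives
  \<open>u * y = x * v\<close>. Applying \<phi> makes the right side 0, while \<phi> y is
  nonzero.\<close>

lemma has_value_0_numerator:
  fixes r :: "qab_ratfun"
  assumes "ring_hom_on \<phi>" "has_value \<phi> r 0"
  shows "\<phi> (fst (quot_of_fract r)) = 0"
proof -
  interpret evaluation \<phi> using assms(1) by (simp add: evaluation_def)
  obtain x y where 1: "r = to_fract x / to_fract y" "\<phi> y \<noteq> 0" "0 = \<phi> x / \<phi> y"
    using assms(2) by (auto simp: has_value_def)
  hence x: "\<phi> x = 0" by simp
  have "y \<noteq> 0" using 1 nonzero_of_hom by blast
  define u v where "u = fst (quot_of_fract r)" and "v = snd (quot_of_fract r)"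
  have v: "v \<noteq> 0" by (simp add: v_def)
  have "r = to_fract u / to_fract v"
    unfolding u_def v_def by (simp flip: Fract_conv_to_fract)
  hence "to_fract u * to_fract y = to_fract x * to_fract v"
    using 1(1) v \<open>y \<noteq> 0\<close> by (simp add: field_simps)
  hence "u * y = x * v" by (simp flip: to_fract_mult)
  hence "\<phi> u * \<phi> y = 0" using x by (metis hom_mult mult_zero_left)
  thus ?thesis using 1(2) by (simp add: u_def)
qed

definition eval_q :: "complex \<Rightarrow> int poly \<Rightarrow> complex" where
  "eval_q Q = (\<lambda>p. poly (map_poly of_int p) Q)"

definition eval_qa :: "complex \<Rightarrow> complex \<Rightarrow> int poly poly \<Rightarrow> complex" where
  "eval_qa Q \<alpha> = (\<lambda>p. poly (map_poly (eval_q Q) p) \<alpha>)"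

definition eval_qab :: "complex \<Rightarrow> complex \<Rightarrow> complex \<Rightarrow> qab_poly \<Rightarrow> complex" where
  "eval_qab Q \<alpha> \<beta> = (\<lambda>p. poly (map_poly (eval_qa Q \<alpha>) p) \<beta>)"

interpretation of_int_hom: ring_hom_on "of_int :: int \<Rightarrow> complex"
  by unfold_locales simp_all

interpretation eval_q: ring_hom_on "eval_q Q"
  unfolding eval_q_def by (rule of_int_hom.eval_hom)

interpretation eval_qa: ring_hom_on "eval_qa Q \<alpha>"
  unfolding eval_qa_def by (rule eval_q.eval_hom)

interpretation eval_qab: ring_hom_on "eval_qab Q \<alpha> \<beta>"
  unfolding eval_qab_def by (rule eval_qa.eval_hom)

interpretation eval_qab: evaluation "eval_qab Q \<alpha> \<beta>"
  by (simp add: evaluation_def eval_qab.ring_hom_on_axioms)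

lemma eval_indets [simp]:
  "eval_qab Q \<alpha> \<beta> indet_q = Q" "eval_qab Q \<alpha> \<beta> indet_a = \<alpha>" "eval_qab Q \<alpha> \<beta> indet_b = \<beta>"
  by (simp_all add: indet_q_def indet_a_def indet_b_def eval_qab_def eval_qa_def eval_q_def
      map_poly_pCons)

section \<open>From infinitely many zeros to divisibility\<close>

lemma poly_eq_0_if_infinite:
  fixes p :: "'a::idom poly"
  assumes "infinite S" "\<And>x. x \<in> S \<Longrightarrow> poly p x = 0"
  shows "p = 0"
proof (rule ccontr)
  assume "p \<noteq> 0"
  hence "finite {x. poly p x = 0}" by (rule poly_roots_finite)
  hence "finite S" by (rule finite_subset[rotated]) (use assms(2) in auto)
  thus False using assms(1) by simp
qed

lemma infinite_norm_gt_1: "infinite {z::complex. norm z > 1}"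
proof
  assume "finite {z::complex. norm z > 1}"
  moreover have "norm (of_nat (k + 2) :: complex) > 1" for k
    by (simp only: norm_of_nat)
  ultimately have "finite (range (\<lambda>k. of_nat (k + 2) :: complex))"
    by (elim finite_subset[rotated]) blast
  moreover have "inj (\<lambda>k. of_nat (k + 2) :: complex)" by (auto intro!: injI)
  ultimately show False using finite_imageD infinite_UNIV_nat by blast
qed

lemma infinite_norm_lt_1: "infinite {z::complex. z \<noteq> 0 \<and> norm z < 1}"
proof
  assume "finite {z::complex. z \<noteq> 0 \<and> norm z < 1}"
  hence "finite (inverse ` {z::complex. z \<noteq> 0 \<and> norm z < 1})" by (rule finite_imageI)
  moreover have "{z::complex. norm z > 1} \<subseteq> inverse ` {z::complex. z \<noteq> 0 \<and> norm z < 1}"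
  proof
    fix z :: complex assume z: "z \<in> {z. norm z > 1}"
    hence "z = inverse (inverse z)" "inverse z \<noteq> 0" "norm (inverse z) < 1"
      by (auto simp: norm_inverse inverse_less_1_iff)
    thus "z \<in> inverse ` {z::complex. z \<noteq> 0 \<and> norm z < 1}" by blast
  qed
  ultimately show False using infinite_norm_gt_1 finite_subset by blast
qed

text \<open>The factors of the modulus do not involve b, so dividing by them is a matter of the
  coefficients in b; this lemma moves the zeros of \<open>F\<close> to those coefficients.\<close>

lemma coeff_eval_eq_0:
  assumes "infinite S" "\<And>\<beta>. \<beta> \<in> S \<Longrightarrow> eval_qab Q \<alpha> \<beta> F = 0"
  shows "eval_qa Q \<alpha> (coeff F i) = 0"
proof -
  have "map_poly (eval_qa Q \<alpha>) F = 0"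
    by (rule poly_eq_0_if_infinite[OF assms(1)]) (use assms(2) in \<open>simp add: eval_qab_def\<close>)
  thus ?thesis by (metis coeff_0 coeff_map_poly eval_qa.hom_0)
qed

lemma coeff_eval_eq_0':
  assumes "infinite S" "\<And>\<alpha>. \<alpha> \<in> S \<Longrightarrow> eval_qa Q \<alpha> c = 0"
  shows "eval_q Q (coeff c i) = 0"
proof -
  have "map_poly (eval_q Q) c = 0"
    by (rule poly_eq_0_if_infinite[OF assms(1)]) (use assms(2) in \<open>simp add: eval_qa_def\<close>)
  thus ?thesis by (metis coeff_0 coeff_map_poly eval_q.hom_0)
qed

lemma eval_q_eq_0:
  assumes "infinite S" "\<And>Q. Q \<in> S \<Longrightarrow> eval_q Q f = 0"
  shows "f = 0"
proof -
  have "(map_poly of_int f :: complex poly) = 0"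
    by (rule poly_eq_0_if_infinite[OF assms(1)]) (use assms(2) in \<open>simp add: eval_q_def\<close>)
  thus ?thesis by (simp add: map_poly_eq_0_iff)
qed

lemma eval_q_monom [simp]: "eval_q Q (monom c n) = of_int c * Q ^ n"
  by (simp add: eval_q_def map_poly_monom poly_monom)

lemma linear_dvd_if_eval_0:
  assumes "infinite S" "\<And>Q. Q \<in> S \<Longrightarrow> eval_qa Q (Q ^ n) c = 0"
  shows "[:- monom 1 n, 1:] dvd c"
proof -
  have "poly c (monom 1 n) = 0"
    by (rule eval_q_eq_0[OF assms(1)]) (use assms(2) in \<open>simp add: eval_q.eval_poly eval_qa_def\<close>)
  thus ?thesis by (simp add: poly_eq_0_iff_dvd)
qed

text \<open>The leading coefficient -q^n is not a unit for n > 0, so the factor theorem does not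
  apply over the integers. As the constant term is 1, division runs from the lowest coefficient:
  subtracting f(1 - a q^n) clears the constant term f and leaves a times \<open>r\<close>, of
  smaller degree. Since a = Q^-n is nonzero, \<open>r\<close> keeps the zeros.\<close>

lemma reversed_linear_dvd_if_eval_0:
  assumes S: "infinite S" "0 \<notin> S" and 0: "\<And>Q. Q \<in> S \<Longrightarrow> eval_qa Q (1 / Q ^ n) c = 0"
  shows "[:1, - monom 1 n:] dvd c"
  using 0
proof (induction "degree c" arbitrary: c rule: less_induct)
  case less
  obtain f p where c: "c = pCons f p" by (cases c) auto
  show ?case
  proof (cases "p = 0")
    case True
    have "f = 0"
      by (rule eval_q_eq_0[OF S(1)]) (use less.prems c True in \<open>simp add: eval_qa_def\<close>)
    thus ?thesis using c True by simp
  next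
    case False
    define r where "r = p + [:f * monom 1 n:]"
    have cr: "c = [:1, - monom 1 n:] * [:f:] + pCons 0 r"
      by (simp add: c r_def)
    have "degree r \<le> degree p"
      unfolding r_def by (rule degree_add_le) auto
    also have "\<dots> < degree c" using False by (simp add: c)
    finally have "degree r < degree c" .
    moreover have "eval_qa Q (1 / Q ^ n) r = 0" if Q: "Q \<in> S" for Q
    proof -
      have "Q \<noteq> 0" using Q S by auto
      have "eval_q Q f + 1 / Q ^ n * poly (map_poly (eval_q Q) p) (1 / Q ^ n) = 0"
        using less.prems[OF Q] by (simp add: c eval_qa_def)
      thus ?thesis using \<open>Q \<noteq> 0\<close>
        by (simp add: r_def eval_qa_def eval_q.eval_add field_simps)
    qed
    ultimately have "[:1, - monom 1 n:] dvd r" by (rule less.hyps)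
    hence "[:1, - monom 1 n:] dvd [:0, 1:] * r" by (rule dvd_mult)
    hence "[:1, - monom 1 n:] dvd pCons 0 r" by simp
    thus ?thesis unfolding cr by (rule dvd_add[OF dvd_triv_left])
  qed
qed

lemma prod_linear_dvd:
  fixes p :: "'a::field poly"
  assumes "finite A" "\<And>z. z \<in> A \<Longrightarrow> poly p z = 0"
  shows "(\<Prod>z\<in>A. [:- z, 1:]) dvd p"
  using assms
proof (induction A arbitrary: p rule: finite_induct)
  case (insert z A)
  obtain r where r: "p = [:- z, 1:] * r"
    using insert.prems[of z] by (auto simp: poly_eq_0_iff_dvd)
  have "(\<Prod>z\<in>A. [:- z, 1:]) dvd r"
  proof (rule insert.IH)
    fix w assume "w \<in> A"
    thus "poly r w = 0" using insert.prems[of w] insert.hyps by (auto simp: r)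
  qed
  thus ?case unfolding r prod.insert[OF insert.hyps] by (rule mult_dvd_mono[OF dvd_refl])
qed simp

text \<open>The distinct roots give divisibility over the complex numbers. It descends to the
  integers because the divisor is monic: pseudo-division is then true division, and its remainder is
  divisible by a polynomial of larger degree.\<close>

lemma cyclotomic_poly_dvd:
  assumes n: "n > 0" and 0: "\<And>z. z \<in> primitive_roots_of_unity n \<Longrightarrow> eval_q z f = 0"
  shows "cyclotomic_poly n dvd f"
proof -
  let ?C = "cyclotomic_poly n"
  have C: "map_poly of_int ?C = cyclotomic_complex n" using n by (rule of_int_cyclotomic_poly)
  have "finite (primitive_roots_of_unity n)"
    by (rule finite_subset[OF _ finite_nth_roots[OF n, of 1]]) (auto simp: primitive_roots_of_unity_def)
  hence dvd: "cyclotomic_complex n dvd map_poly of_int f"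
    unfolding cyclotomic_complex_def by (rule prod_linear_dvd) (use 0 in \<open>simp add: eval_q_def\<close>)
  have "of_int (lead_coeff ?C) = lead_coeff (cyclotomic_complex n)"
    unfolding C[symmetric] by (simp add: degree_map_poly coeff_map_poly)
  also have "\<dots> = 1" unfolding cyclotomic_complex_def by (rule lead_coeff_prod_linear)
  finally have lc: "lead_coeff ?C = 1" by (simp only: of_int_eq_1_iff)
  hence C0: "?C \<noteq> 0" by auto
  obtain g r where gr: "pseudo_divmod f ?C = (g, r)"
    by (cases "pseudo_divmod f ?C")
  have eq: "f = ?C * g + r" and r: "r = 0 \<or> degree r < degree ?C"
    using pseudo_divmod[OF C0 gr] lc by simp_all
  have "cyclotomic_complex n dvd map_poly of_int r"
    using dvd unfolding eq of_int_poly_add of_int_poly_mult C by (simp add: dvd_add_right_iff)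
  hence "(map_poly of_int r :: complex poly) = 0 \<or> degree (cyclotomic_complex n) \<le> degree (map_poly of_int r :: complex poly)"
    by (auto dest: dvd_imp_degree_le)
  with r have "r = 0"
    unfolding C[symmetric] by (auto simp: degree_map_poly map_poly_eq_0_iff)
  thus ?thesis using eq by simp
qed

subsection \<open>The congruence\<close>

lemma eval_numerator_generic:
  fixes Q \<alpha> \<beta> :: complex
  assumes n: "odd n" and Q: "norm Q > 1" and \<beta>: "\<beta> \<noteq> 0" "norm \<beta> < 1"
    and \<alpha>: "\<alpha> = Q ^ n \<or> \<alpha> = 1 / Q ^ n"
    and F: "F = fst (quot_of_fract (lhs_sum n (to_fract indet_q) (to_fract indet_a) (to_fract indet_b)
      - rhs_sum n (to_fract indet_q) (to_fract indet_a) (to_fract indet_b)))"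
  shows "eval_qab Q \<alpha> \<beta> F = 0"
proof -
  have Q0: "Q \<noteq> 0" using Q by auto
  have Qk: "Q ^ k \<noteq> 1" if "k > 0" for k
    using one_less_power[OF Q that] by (metis norm_one norm_power order_less_irrefl)
  have Qb: "\<beta> \<noteq> Q ^ k" for k
    using one_le_power[OF less_imp_le[OF Q], of k] \<beta>(2) by (auto simp: norm_power)
  define a where "a = 1 / Q ^ n"
  have a: "a * Q ^ n = 1" "a \<noteq> 0" using Q0 by (simp_all add: a_def)
  note d = denominators_nonzero[OF n Q0 Qk a(1) \<beta>(1) Qb]
  note eq = lhs_sum_eq_rhs_sum[OF n Q0 Qk a(1) \<beta>(1) Qb]
  have \<alpha>': "\<alpha> = a \<or> \<alpha> = 1 / a" using \<alpha> by (auto simp: a_def)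
  have "has_value (eval_qab Q \<alpha> \<beta>)
      (lhs_sum n (to_fract indet_q) (to_fract indet_a) (to_fract indet_b)
      - rhs_sum n (to_fract indet_q) (to_fract indet_a) (to_fract indet_b))
      (lhs_sum n Q \<alpha> \<beta> - rhs_sum n Q \<alpha> \<beta>)"
  proof (rule eval_qab.has_value_lhs_rhs)
    show "has_value (eval_qab Q \<alpha> \<beta>) (to_fract indet_q) Q"
      using eval_qab.has_value_to_fract[of Q \<alpha> \<beta> indet_q] by simp
    show "has_value (eval_qab Q \<alpha> \<beta>) (to_fract indet_a) \<alpha>"
      using eval_qab.has_value_to_fract[of Q \<alpha> \<beta> indet_a] by simp
    show "has_value (eval_qab Q \<alpha> \<beta>) (to_fract indet_b) \<beta>"
      using eval_qab.has_value_to_fract[of Q \<alpha> \<beta> indet_b] by simp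
  qed (use \<alpha>' a Q0 \<beta> d in \<open>auto simp: mult.commute\<close>)
  also have "lhs_sum n Q \<alpha> \<beta> = rhs_sum n Q \<alpha> \<beta>"
    using \<alpha>' eq by (auto simp: lhs_sum_inverse rhs_sum_inverse)
  finally show ?thesis
    unfolding F by (intro has_value_0_numerator) (simp_all add: eval_qab.ring_hom_on_axioms)
qed

lemma eval_numerator_root_of_unity:
  fixes z \<alpha> \<beta> :: complex
  assumes n: "odd n" "n > 1" and z: "z \<in> primitive_roots_of_unity n"
    and \<alpha>: "\<alpha> \<noteq> 0" "norm \<alpha> < 1" and \<beta>: "\<beta> \<noteq> 0" "norm \<beta> < 1"
    and F: "F = fst (quot_of_fract (lhs_sum n (to_fract indet_q) (to_fract indet_a) (to_fract indet_b)
      - rhs_sum n (to_fract indet_q) (to_fract indet_a) (to_fract indet_b)))"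
  shows "eval_qab z \<alpha> \<beta> F = 0"
proof -
  have zm: "z ^ m \<noteq> 1" if "0 < m" "m < n" for m
    using z that by (auto simp: primitive_roots_of_unity_def)
  have zn: "z ^ n = 1" using z by (simp add: primitive_roots_of_unity_def)
  have z1: "z \<noteq> 1" using zm[of 1] n by auto
  have z0: "z \<noteq> 0" using zn n by (auto simp: power_0_left)
  have "norm z ^ n = 1 ^ n" using zn by (metis norm_one norm_power power_one)
  hence "norm z = 1" by (rule power_eq_imp_eq_base) (use n in auto)
  hence zk: "norm (z ^ k) = 1" for k by (simp add: norm_power)
  have a2: "\<alpha> * z ^ k \<noteq> 1" for k
    using \<alpha>(2) zk[of k] by (metis norm_mult mult.right_neutral norm_one order_less_irrefl)
  have a3: "\<alpha> \<noteq> z ^ k" and b2: "\<beta> \<noteq> z ^ k" for k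
    using \<alpha>(2) \<beta>(2) zk[of k] by auto
  have d: "q_poch (z ^ 2 / x) (z ^ 2) k \<noteq> 0"
    if "x \<in> {\<alpha>, 1 / \<alpha>, \<beta>, 1}" "k \<le> (n - 1) div 2" for x k
    by (rule denominators_nonzero_root_of_unity[OF zm \<alpha>(1) a2 a3 \<beta>(1) b2 that])
  have "has_value (eval_qab z \<alpha> \<beta>)
      (lhs_sum n (to_fract indet_q) (to_fract indet_a) (to_fract indet_b)
      - rhs_sum n (to_fract indet_q) (to_fract indet_a) (to_fract indet_b))
      (lhs_sum n z \<alpha> \<beta> - rhs_sum n z \<alpha> \<beta>)"
  proof (rule eval_qab.has_value_lhs_rhs)
    show "has_value (eval_qab z \<alpha> \<beta>) (to_fract indet_q) z"
      using eval_qab.has_value_to_fract[of z \<alpha> \<beta> indet_q] by simp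
    show "has_value (eval_qab z \<alpha> \<beta>) (to_fract indet_a) \<alpha>"
      using eval_qab.has_value_to_fract[of z \<alpha> \<beta> indet_a] by simp
    show "has_value (eval_qab z \<alpha> \<beta>) (to_fract indet_b) \<beta>"
      using eval_qab.has_value_to_fract[of z \<alpha> \<beta> indet_b] by simp
    fix k assume k: "k \<le> (n - 1) div 2"
    show "q_poch (z\<^sup>2) (z\<^sup>2) k \<noteq> 0" using d[where x = 1, OF _ k] by simp
    show "q_poch (\<alpha> * z\<^sup>2) (z\<^sup>2) k \<noteq> 0" using d[where x = "1 / \<alpha>", OF _ k] by (simp add: mult.commute)
    show "q_poch (z\<^sup>2 / \<alpha>) (z\<^sup>2) k \<noteq> 0" using d[where x = \<alpha>, OF _ k] by simp
    show "q_poch (z\<^sup>2 / \<beta>) (z\<^sup>2) k \<noteq> 0" using d[where x = \<beta>, OF _ k] by simp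
  qed (use z0 \<alpha> \<beta> in auto)
  also have "lhs_sum n z \<alpha> \<beta> = 0"
    by (rule lhs_sum_root_of_unity[OF n zn zm \<alpha>(1) a2 a3 \<beta>(1) b2])
  also have "rhs_sum n z \<alpha> \<beta> = 0"
    by (rule rhs_sum_root_of_unity[OF zn z1])
  finally show ?thesis
    unfolding F by (intro has_value_0_numerator) (simp_all add: eval_qab.ring_hom_on_axioms)
qed

lemma indet_q_power: "indet_q ^ n = [:[:monom 1 n:]:]"
  by (simp add: indet_q_def poly_const_pow monom_altdef)

text \<open>The factors are split off one by one in place of a coprimality argument. A cofactor
  inherits the next zeros because the factors already removed do not vanish there: a - q^n becomes
  Q^-n - Q^n with |Q| > 1, and at a root of unity both linear factors become 1 - \<alpha> up to
  sign, with |\<alpha>| < 1.\<close>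

lemma lhs_sum_cong_rhs_sum:
  fixes n :: nat
  assumes n: "odd n"
  defines "q \<equiv> to_fract indet_q" and "a \<equiv> to_fract indet_a" and "b \<equiv> to_fract indet_b"
  shows "ratfun_cong (lhs_sum n q a b) (rhs_sum n q a b)
    (poly_in_q (cyclotomic_poly n) * (1 - indet_a * indet_q ^ n) * (indet_a - indet_q ^ n))"
proof (cases "n = 1")
  \<comment> \<open>The primitive first root of unity is 1, where [1] does not vanish, so the
    argument for roots of unity fails; but here both sides equal 1.\<close>
  case True
  hence "lhs_sum n q a b = rhs_sum n q a b"
    by (simp add: lhs_sum_def rhs_sum_def q_poch_list_def q_integer_def)
  thus ?thesis by (simp add: ratfun_cong_def)
next
  case False
  with n have n1: "n > 1" by (cases "n = 0") auto
  define F where "F = fst (quot_of_fract (lhs_sum n q a b - rhs_sum n q a b))"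
  define S1 where "S1 = {z::complex. norm z > 1}"
  define S2 where "S2 = {z::complex. z \<noteq> 0 \<and> norm z < 1}"
  have S: "infinite S1" "infinite S2" "0 \<notin> S1"
    using infinite_norm_gt_1 infinite_norm_lt_1 by (simp_all add: S1_def S2_def)
  have lin1: "indet_a - indet_q ^ n = [:[:- monom 1 n, 1:]:]"
    by (simp add: indet_q_power indet_a_def)
  have lin2: "1 - indet_a * indet_q ^ n = [:[:1, - monom 1 n:]:]"
    by (simp add: indet_q_power indet_a_def one_pCons)
  have "(indet_a - indet_q ^ n) dvd F"
    unfolding lin1 const_poly_dvd_iff
  proof
    fix i
    show "[:- monom 1 n, 1:] dvd coeff F i"
      by (rule linear_dvd_if_eval_0[OF S(1)], rule coeff_eval_eq_0[OF S(2)],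
          rule eval_numerator_generic[OF n])
         (simp_all add: S1_def S2_def F_def q_def a_def b_def)
  qed
  then obtain F1 where F1: "F = (indet_a - indet_q ^ n) * F1" by (elim dvdE)
  have eval_F1: "eval_qab Q (1 / Q ^ n) \<beta> F1 = 0" if "Q \<in> S1" "\<beta> \<in> S2" for Q \<beta>
  proof -
    have Q: "norm Q > 1" "Q \<noteq> 0" using that by (auto simp: S1_def)
    have "eval_qab Q (1 / Q ^ n) \<beta> F = 0"
      by (rule eval_numerator_generic[OF n])
         (use that in \<open>simp_all add: S1_def S2_def F_def q_def a_def b_def\<close>)
    hence "(1 / Q ^ n - Q ^ n) * eval_qab Q (1 / Q ^ n) \<beta> F1 = 0"
      by (simp add: F1)
    moreover have "1 / Q ^ n \<noteq> Q ^ n"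
    proof
      assume "1 / Q ^ n = Q ^ n"
      hence "Q ^ n * Q ^ n = 1" using Q by (simp add: field_simps)
      hence "norm Q ^ (n + n) = 1" by (metis norm_one norm_power power_add)
      thus False using one_less_power[OF Q(1), of "n + n"] n1 by simp
    qed
    ultimately show ?thesis by simp
  qed
  have "(1 - indet_a * indet_q ^ n) dvd F1"
    unfolding lin2 const_poly_dvd_iff
  proof
    fix i
    show "[:1, - monom 1 n:] dvd coeff F1 i"
      by (rule reversed_linear_dvd_if_eval_0[OF S(1,3)], rule coeff_eval_eq_0[OF S(2)], rule eval_F1)
  qed
  then obtain F2 where F2: "F1 = (1 - indet_a * indet_q ^ n) * F2" by (elim dvdE)
  have eval_F2: "eval_qab z \<alpha> \<beta> F2 = 0"
    if "z \<in> primitive_roots_of_unity n" "\<alpha> \<in> S2" "\<beta> \<in> S2" for z \<alpha> \<beta>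
  proof -
    have "z ^ n = 1" using that(1) by (simp add: primitive_roots_of_unity_def)
    have "eval_qab z \<alpha> \<beta> F = 0"
      by (rule eval_numerator_root_of_unity[OF n n1 that(1)])
         (use that in \<open>simp_all add: S2_def F_def q_def a_def b_def\<close>)
    hence "(\<alpha> - 1) * (1 - \<alpha>) * eval_qab z \<alpha> \<beta> F2 = 0"
      by (simp add: F1 F2 \<open>z ^ n = 1\<close>)
    moreover have "\<alpha> \<noteq> 1" using that(2) by (auto simp: S2_def)
    ultimately show ?thesis by simp
  qed
  have "poly_in_q (cyclotomic_poly n) dvd F2"
    unfolding poly_in_q_def const_poly_dvd_iff
  proof (intro allI)
    fix i j
    show "cyclotomic_poly n dvd coeff (coeff F2 i) j"
      by (rule cyclotomic_poly_dvd, use n1 in simp, rule coeff_eval_eq_0'[OF S(2)],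
          rule coeff_eval_eq_0[OF S(2)], rule eval_F2)
  qed
  hence "poly_in_q (cyclotomic_poly n) * (1 - indet_a * indet_q ^ n) * (indet_a - indet_q ^ n) dvd F"
    unfolding F1 F2 by (simp add: mult_dvd_mono mult_ac)
  thus ?thesis by (simp add: ratfun_cong_def F_def)
qed

theorem theorem3p3:
  fixes n :: nat and q a b :: qab_ratfun
  assumes n: "odd n"
  defines "q \<equiv> to_fract indet_q" and "a \<equiv> to_fract indet_a" and "b \<equiv> to_fract indet_b"
  shows "ratfun_cong
    (\<Sum>k = 0..(n - 1) div 2.
       q_integer q (4 * k + 1)
       * ((q_poch_list [a * q, q / a, b * q] (q ^ 2) k * q_poch q (q ^ 2) k ^ 3)
          / (q_poch_list [a * q ^ 2, q ^ 2 / a, q ^ 2 / b] (q ^ 2) k * q_poch (q ^ 2) (q ^ 2) k ^ 3))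
       * (q / b) ^ k)
    (q_integer q n * q powi ((1 - int n) div 2)
     * (\<Sum>k = 0..(n - 1) div 2.
          q_poch_list [a * q, q / a, q / b, q] (q ^ 2) k
          / (q_poch (q ^ 2 / b) (q ^ 2) k * q_poch (q ^ 2) (q ^ 2) k ^ 3)
          * q ^ (2 * k)))
    (poly_in_q (cyclotomic_poly n) * (1 - indet_a * indet_q ^ n) * (indet_a - indet_q ^ n))"
  unfolding assms(2-4)
  by (rule lhs_sum_cong_rhs_sum[OF n, unfolded lhs_sum_def rhs_sum_def])

end
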